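(* There are absolute constants $c>0$ and $C>0$ such that \[ c\,(m\log m)^{2/3} < \mathrm{ISO}(m) < C\,(m\log m)^{2/3}. \]
   Context: For a graph $G$, its self-similarity $\mathrm{ISO}(G)$ is the largest integer $s$ such that $G$ contains a pair of edge-disjoint isomorphic subgraphs with $s$ edges each. For a positive integer $m$, $\mathrm{ISO}(m)$ is the minimum of $\mathrm{ISO}(G)$ over all graphs $G$ with exactly $m$ edges. All logarithms are natural logarithms.
   Formalization: The inequalities are proved for all m ≥ 2; m = 1 is excluded because there log m = 0 and ISO(1) = 0, so the strict inequalities would read 0 < 0 < 0. *)

theory Defs
  imports Complex_Main
begin

type_synonym 'a sgraph = "'a set \<times> 'a set set"

abbreviation verts :: "'a sgraph \<Rightarrow> 'a set" where "verts \<equiv> fst"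

abbreviation edges :: "'a sgraph \<Rightarrow> 'a set set" where "edges \<equiv> snd"

definition finite_simple_graph :: "'a sgraph \<Rightarrow> bool" where
  "finite_simple_graph G \<longleftrightarrow>
     finite (verts G) \<and> (\<forall>e\<in>edges G. e \<subseteq> verts G \<and> card e = 2)"

text \<open>Subgraphs need be neither induced nor spanning.\<close>

definition subgraph_of :: "'a sgraph \<Rightarrow> 'a sgraph \<Rightarrow> bool" where
  "subgraph_of H G \<longleftrightarrow>
     finite_simple_graph H \<and> verts H \<subseteq> verts G \<and> edges H \<subseteq> edges G"

definition graph_isomorphic :: "'a sgraph \<Rightarrow> 'b sgraph \<Rightarrow> bool" where
  "graph_isomorphic G H \<longleftrightarrow>
     (\<exists>f. bij_betw f (verts G) (verts H) \<and>
          (\<forall>u\<in>verts G. \<forall>v\<in>verts G. {u, v} \<in> edges G \<longleftrightarrow> {f u, f v} \<in> edges H))"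

text \<open>For a finite simple graph the set below contains 0 (witnessed by two empty subgraphs) and is
  bounded by the number of edges, so the maximum exists. The two subgraphs may share vertices.\<close>

definition self_similarity :: "'a sgraph \<Rightarrow> nat" where
  "self_similarity G =
     Max {s. \<exists>H K. subgraph_of H G \<and> subgraph_of K G \<and>
                   edges H \<inter> edges K = {} \<and> graph_isomorphic H K \<and>
                   card (edges H) = s \<and> card (edges K) = s}"

text \<open>Every finite graph is isomorphic to one whose vertices are natural numbers, so these
  represent all graphs. The values range over a nonempty set of naturals (for every \<open>m\<close> there is a
  graph with \<open>m\<close> edges), so the least value is attained.\<close>

definition min_self_similarity :: "nat \<Rightarrow> nat" where
  "min_self_similarity m =
     (LEAST s. \<exists>G :: nat sgraph. finite_simple_graph G \<and> card (edges G) = m \<and>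
                                 self_similarity G = s)"

end

theory Submission
  imports Defs "HOL-Combinatorics.Permutations" "HOL-Real_Asymp.Real_Asymp"
begin

text \<open>Write \<open>n\<^sub>0 = m\<^bsup>2/3\<^esup> (ln m)\<^bsup>-1/3\<^esup>\<close>, so that the target is \<open>T = n\<^sub>0 ln m\<close> and \<open>n\<^sub>0\<^sup>3 ln m = m\<^sup>2\<close>.

  Upper bound: a uniformly random graph with \<open>m\<close> edges on about \<open>n\<^sub>0\<close> vertices works. A copy of size \<open>s\<close>
  comes from a permutation \<open>\<sigma>\<close> and \<open>s\<close> edges disjoint from their \<open>\<sigma>\<close>-images, all \<open>2s\<close> of them present; a union
  bound over \<open>\<sigma>\<close> and the \<open>s\<close> edges succeeds once \<open>s\<close> is a large multiple of \<open>T\<close>.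

  Lower bound: if there are at least \<open>T\<close> non-isolated vertices, matchings and stars suffice. If a set of
  \<open>O(n\<^sub>0)\<close> vertices spans half the edges, a random permutation of it does. In between, take a minimal
  set \<open>U\<close> of \<open>k\<^sup>2 n\<^sub>0\<close> vertices that spans at least \<open>m (1 - 1/(2k))\<close> edges. By minimality the vertices of \<open>U\<close> of
  bounded relative degree still meet \<open>m/(2k)\<close> of these edges, and a maximum cut yields a set \<open>B\<close> of many
  vertices with many neighbours in a set disjoint from \<open>B\<close>. For a random permutation of \<open>U\<close> the
  neighbourhoods of two vertices of \<open>B\<close> have an overlap of \<open>(ln m)/k\<close>, far above the mean, with probability at least
  \<open>m\<^bsup>-1/20\<^esup>\<close>. This is enough to match a positive proportion of \<open>B\<close> into such pairs.\<close>

section \<open>Self-similarity and partial injections\<close>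

text \<open>On \<open>k^2 * n0\<close> vertices a random permutation by itself maps only about
  \<open>m^2 / (k^4 * n0^2) = T / k^4\<close> edges to edges, so for unbounded \<open>k\<close>
  partners must be chosen after the permutation is drawn. Polynomially many candidates make an event
  of probability \<open>m^(-1/20)\<close> available to a positive proportion of vertices. As a
  function of the size, the slack \<open>1 / (2 * k)\<close> is half of
  \<open>sqrt (n0 / card U)\<close>. Vertices of degree above \<open>8 * m / card U\<close>, four
  times the largest possible average, fill at most a quarter of \<open>U\<close>. For a set that
  small the slack has at least doubled to \<open>1 / k\<close>, and this is what leaves
  \<open>m / (2 * k)\<close> edges at the other vertices. Dividing by their degree bound gives order
  \<open>k * n0\<close> vertices in \<open>B\<close>; an overlap \<open>ln m / k\<close> at each
  yields order \<open>T\<close>, the powers of \<open>k\<close> cancelling. Neighbourhoods of size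
  \<open>D\<close> of order \<open>m / (k^3 * n0)\<close> have mean overlap of order
  \<open>ln m / k^8\<close>. Exceeding it by a factor of order \<open>k^7\<close> has probability
  about \<open>m\<close> to the power \<open>-O(ln k / k)\<close>, so \<open>k\<close> only has to
  be at least a constant \<open>K\<close>; smaller \<open>k\<close> belong to the dense
  case.\<close>

lemma finite_edges:
  assumes "finite_simple_graph G"
  shows "finite (edges G)"
proof (rule finite_subset)
  show "edges G \<subseteq> Pow (verts G)"
    using assms by (auto simp: finite_simple_graph_def)
  show "finite (Pow (verts G))"
    using assms by (simp add: finite_simple_graph_def)
qed

lemma edge_card: "finite_simple_graph G \<Longrightarrow> e \<in> edges G \<Longrightarrow> card e = 2"
  by (simp add: finite_simple_graph_def)

definition similarity_values :: "'a sgraph \<Rightarrow> nat set" where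
  "similarity_values G = {s. \<exists>H K. subgraph_of H G \<and> subgraph_of K G \<and>
                   edges H \<inter> edges K = {} \<and> graph_isomorphic H K \<and>
                   card (edges H) = s \<and> card (edges K) = s}"

lemma similarity_values_le:
  assumes "finite_simple_graph G" "s \<in> similarity_values G"
  shows "s \<le> card (edges G)"
  using assms finite_edges[OF assms(1)]
  by (auto simp: similarity_values_def subgraph_of_def intro: card_mono)

lemma finite_similarity_values:
  assumes "finite_simple_graph G"
  shows "finite (similarity_values G)"
proof (rule finite_subset)
  show "similarity_values G \<subseteq> {..card (edges G)}"
    using similarity_values_le[OF assms] by blast
qed simp

lemma zero_in_similarity_values:
  assumes "finite_simple_graph G"
  shows "0 \<in> similarity_values G"
  unfolding similarity_values_def mem_Collect_eq
  by (rule exI[of _ "({},{})"], rule exI[of _ "({},{})"])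
     (auto simp: subgraph_of_def finite_simple_graph_def graph_isomorphic_def)

lemma self_similarity_eq: "self_similarity G = Max (similarity_values G)"
  by (simp add: self_similarity_def similarity_values_def)

lemma self_similarity_le_edges:
  assumes "finite_simple_graph G"
  shows "self_similarity G \<le> card (edges G)"
  unfolding self_similarity_eq
  using Max_in[OF finite_similarity_values[OF assms]] zero_in_similarity_values[OF assms]
    similarity_values_le[OF assms] by blast

lemma inj_on_image_sets:
  assumes "inj_on f A" "\<Union>\<A> \<subseteq> A"
  shows "inj_on ((`) f) \<A>"
proof -
  have "\<A> \<subseteq> Pow A" using assms(2) by blast
  then show ?thesis using inj_on_image_Pow[OF assms(1)] inj_on_subset by blast
qed

text \<open>The subgraphs may be taken without isolated vertices, so an injection on the end points
  of \<open>E\<close> is all that has to be built. Every lower bound below enters through this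
  form.\<close>

lemma self_similarity_ge:
  assumes G: "finite_simple_graph G" and inj: "inj_on f (\<Union>E)"
    and E: "E \<subseteq> edges G" and fE: "(`) f ` E \<subseteq> edges G"
    and disj: "E \<inter> (`) f ` E = {}"
  shows "card E \<le> self_similarity G"
proof -
  define H where "H = (\<Union>E, E)"
  define K where "K = (f ` \<Union>E, (`) f ` E)"
  have fin: "finite (verts G)" and sub: "\<And>e. e \<in> edges G \<Longrightarrow> e \<subseteq> verts G"
    and card2: "\<And>e. e \<in> edges G \<Longrightarrow> card e = 2"
    using G by (simp_all add: finite_simple_graph_def)
  have UE: "\<Union>E \<subseteq> verts G" using E sub by blast
  have fUE: "f ` \<Union>E \<subseteq> verts G" 
    unfolding image_Union using fE sub by blast
  have H: "subgraph_of H G"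
    unfolding subgraph_of_def H_def finite_simple_graph_def fst_conv snd_conv
    using E UE card2 finite_subset[OF UE fin] by blast
  have K: "subgraph_of K G"
    unfolding subgraph_of_def K_def finite_simple_graph_def fst_conv snd_conv
    using fE fUE card2 finite_subset[OF fUE fin] by blast
  have injE: "inj_on ((`) f) E"
    using inj by (rule inj_on_image_sets) simp
  have "{u, v} \<in> E \<longleftrightarrow> {f u, f v} \<in> (`) f ` E" if "u \<in> \<Union>E" "v \<in> \<Union>E" for u v
  proof
    assume "{u, v} \<in> E"
    then have "f ` {u, v} \<in> (`) f ` E" by blast
    then show "{f u, f v} \<in> (`) f ` E" by simp
  next
    assume "{f u, f v} \<in> (`) f ` E"
    then obtain e where e: "e \<in> E" "f ` e = f ` {u, v}" by auto
    have "e = {u, v}"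
      using e that inj inj_on_image_eq_iff[OF inj, of e "{u, v}"] by blast
    then show "{u, v} \<in> E" using e by simp
  qed
  then have iso: "graph_isomorphic H K"
    unfolding graph_isomorphic_def H_def K_def
    using inj by (intro exI[of _ f]) (auto simp: bij_betw_def)
  have "card E \<in> similarity_values G"
    unfolding similarity_values_def using H K iso disj card_image[OF injE]
    by (auto simp: H_def K_def intro!: exI[of _ H] exI[of _ K])
  then show ?thesis
    unfolding self_similarity_eq using finite_similarity_values[OF G] by simp
qed

text \<open>The converse form, from which the union bound over graphs with large self-similarity
  starts.\<close>

lemma self_similarity_witness:
  assumes G: "finite_simple_graph G"
  obtains E f where "inj_on f (\<Union>E)" "E \<subseteq> edges G" "(`) f ` E \<subseteq> edges G"
    "E \<inter> (`) f ` E = {}" "card E = self_similarity G"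
proof -
  have "self_similarity G \<in> similarity_values G"
    unfolding self_similarity_eq
    using Max_in[OF finite_similarity_values[OF G]] zero_in_similarity_values[OF G] by blast
  then obtain H K where H: "subgraph_of H G" and K: "subgraph_of K G"
    and disj: "edges H \<inter> edges K = {}" and iso: "graph_isomorphic H K"
    and card: "card (edges H) = self_similarity G"
    unfolding similarity_values_def by blast
  obtain f where f: "bij_betw f (verts H) (verts K)"
    and ff: "\<And>u v. u \<in> verts H \<Longrightarrow> v \<in> verts H \<Longrightarrow> {u, v} \<in> edges H \<longleftrightarrow> {f u, f v} \<in> edges K"
    using iso unfolding graph_isomorphic_def by blast
  have sub: "\<Union>(edges H) \<subseteq> verts H"
    using H by (auto simp: subgraph_of_def finite_simple_graph_def)
  have im: "f ` e \<in> edges K" if "e \<in> edges H" for e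
  proof -
    have "card e = 2" using that H by (auto simp: subgraph_of_def finite_simple_graph_def)
    then obtain u v where "e = {u, v}" by (auto simp: card_2_iff)
    then show ?thesis using ff[of u v] that sub by auto
  qed
  show ?thesis
  proof (rule that[of f "edges H"])
    show "inj_on f (\<Union>(edges H))"
      using f sub by (auto simp: bij_betw_def intro: inj_on_subset)
    show "edges H \<subseteq> edges G" "(`) f ` edges H \<subseteq> edges G"
      using H K im by (auto simp: subgraph_of_def)
    show "edges H \<inter> (`) f ` edges H = {}" using im disj by blast
    show "card (edges H) = self_similarity G" by (fact card)
  qed
qed

text \<open>Two distinct edges are disjoint as edge sets and isomorphic, whether or not they share a
  vertex. This settles the lower bound for small \<open>m\<close>.\<close>

lemma self_similarity_pos:
  assumes G: "finite_simple_graph G" and m: "card (edges G) \<ge> 2"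
  shows "self_similarity G \<ge> 1"
proof -
  obtain e1 e2 where e: "e1 \<in> edges G" "e2 \<in> edges G" "e1 \<noteq> e2"
    using m by (metis card_le_Suc0_iff_eq finite_edges[OF G] not_less_eq_eq numeral_2_eq_2)
  have "card e1 = card e2" "finite e1" "finite e2"
    using e edge_card[OF G] by (auto intro: card_ge_0_finite)
  then obtain f where f: "bij_betw f e1 e2"
    using finite_same_card_bij by blast
  have "card {e1} \<le> self_similarity G"
    by (rule self_similarity_ge[OF G, of f])
       (use f e in \<open>auto simp: bij_betw_def\<close>)
  then show ?thesis by simp
qed

text \<open>\<open>R\<close> is arbitrary because the pairing is used for adjacency, for the trivial
  relation, for having the same centre and for overlapping neighbourhoods. The map \<open>f\<close>
  orients each pair. Reflexive instances occur, so maximality can only conclude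
  \<open>x = y\<close>.\<close>

lemma maximal_matching:
  fixes R :: "'a \<Rightarrow> 'a \<Rightarrow> bool"
  assumes "finite V"
  obtains I f where "I \<subseteq> V" "f ` I \<subseteq> V" "inj_on f I" "I \<inter> f ` I = {}"
    "\<And>x. x \<in> I \<Longrightarrow> R x (f x)"
    "\<And>x y. x \<in> V - (I \<union> f ` I) \<Longrightarrow> y \<in> V - (I \<union> f ` I) \<Longrightarrow> R x y \<Longrightarrow> x = y"
proof -
  have "\<exists>I f. I \<subseteq> V \<and> f ` I \<subseteq> V \<and> inj_on f I \<and> I \<inter> f ` I = {} \<and> (\<forall>x\<in>I. R x (f x)) \<and>
    (\<forall>x \<in> V - (I \<union> f ` I). \<forall>y \<in> V - (I \<union> f ` I). R x y \<longrightarrow> x = y)"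
    using assms
  proof (induction V rule: finite_psubset_induct)
    case (psubset V)
    show ?case
    proof (cases "\<exists>x\<in>V. \<exists>y\<in>V. x \<noteq> y \<and> R x y")
      case True
      then obtain x y where xy: "x \<in> V" "y \<in> V" "x \<noteq> y" "R x y" by blast
      have "V - {x, y} \<subset> V" using xy by blast
      from psubset.IH[OF this] obtain I f where
        If: "I \<subseteq> V - {x, y}" "f ` I \<subseteq> V - {x, y}" "inj_on f I" "I \<inter> f ` I = {}"
        "\<forall>x\<in>I. R x (f x)"
        "\<forall>a \<in> V - {x, y} - (I \<union> f ` I). \<forall>b \<in> V - {x, y} - (I \<union> f ` I). R a b \<longrightarrow> a = b"
        by blast
      have xI: "x \<notin> I" "y \<notin> I" using If(1) by auto
      have im: "f(x := y) ` insert x I = insert y (f ` I)" using xI by auto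
      show ?thesis
      proof (intro exI[of _ "insert x I"] exI[of _ "f(x := y)"] conjI)
        show "inj_on (f(x := y)) (insert x I)"
          using If(2,3) xI by (auto simp: inj_on_def)
        show "\<forall>a\<in>insert x I. R a ((f(x := y)) a)"
          using If(5) xy by auto
        show "insert x I \<subseteq> V" "f(x := y) ` insert x I \<subseteq> V"
          unfolding im using If(1,2) xy by blast+
        show "insert x I \<inter> f(x := y) ` insert x I = {}"
          unfolding im using If(1,2,4) xy by blast
        show "\<forall>a\<in>V - (insert x I \<union> f(x := y) ` insert x I).
            \<forall>b\<in>V - (insert x I \<union> f(x := y) ` insert x I). R a b \<longrightarrow> a = b"
          unfolding im using If(6) by blast
      qed
    next
      case False
      then show ?thesis by (intro exI[of _ "{}"]) auto
    qed
  qed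
  then obtain I f where "I \<subseteq> V" "f ` I \<subseteq> V" "inj_on f I" "I \<inter> f ` I = {}" "\<forall>x\<in>I. R x (f x)"
    "\<forall>x \<in> V - (I \<union> f ` I). \<forall>y \<in> V - (I \<union> f ` I). R x y \<longrightarrow> x = y"
    by (elim exE conjE)
  then show ?thesis by (intro that[of I f]) simp_all
qed

lemma card_matching:
  assumes "finite V" "I \<subseteq> V" "f ` I \<subseteq> V" "inj_on f I" "I \<inter> f ` I = {}"
  shows "card (V - (I \<union> f ` I)) + 2 * card I = card V"
proof -
  have "card (I \<union> f ` I) = 2 * card I"
    using assms by (simp add: card_Un_disjoint card_image finite_subset[OF assms(2,1)])
  moreover have "card (V - (I \<union> f ` I)) + card (I \<union> f ` I) = card V"
    using card_Diff_subset[of "I \<union> f ` I" V] card_mono[of V "I \<union> f ` I"] assms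
    by (simp add: finite_subset[of I])
  ultimately show ?thesis by simp
qed

text \<open>A maximal matching is either large itself, or most vertices hang off its few end points and
  can be paired up at their common centres.\<close>

lemma self_similarity_ge_vertices:
  assumes G: "finite_simple_graph G"
  shows "card (\<Union>(edges G)) \<le> 16 * self_similarity G + 8"
proof -
  define V where "V = \<Union>(edges G)"
  have finV: "finite V"
    unfolding V_def using finite_edges[OF G] edge_card[OF G]
    by (intro finite_Union) (auto intro: card_ge_0_finite)
  obtain I f where I: "I \<subseteq> V" "f ` I \<subseteq> V" "inj_on f I" "I \<inter> f ` I = {}"
    "\<And>x. x \<in> I \<Longrightarrow> {x, f x} \<in> edges G"
    "\<And>x y. x \<in> V - (I \<union> f ` I) \<Longrightarrow> y \<in> V - (I \<union> f ` I) \<Longrightarrow> {x, y} \<in> edges G \<Longrightarrow> x = y"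
    by (rule maximal_matching[OF finV, of "\<lambda>x y. {x, y} \<in> edges G"]) (rule that)
  define X where "X = I \<union> f ` I"
  define J where "J = V - X"
  have finI: "finite I" and finX: "finite X" and finJ: "finite J"
    using I(1,2) finV by (auto simp: X_def J_def intro: finite_subset)
  have cJ: "card J + 2 * card I = card V"
    unfolding J_def X_def by (rule card_matching) (use I finV in auto)
  \<comment> \<open>The matching edges are themselves paired off, with at most one left over; each
    pair supplies an edge and its image.\<close>
  obtain I3 f3 where I3: "I3 \<subseteq> I" "f3 ` I3 \<subseteq> I" "inj_on f3 I3" "I3 \<inter> f3 ` I3 = {}"
    "\<And>x y. x \<in> I - (I3 \<union> f3 ` I3) \<Longrightarrow> y \<in> I - (I3 \<union> f3 ` I3) \<Longrightarrow> x = y"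
    by (rule maximal_matching[OF finI, of "\<lambda>x y. True"]) (rule that, simp_all)
  have cI: "card (I - (I3 \<union> f3 ` I3)) + 2 * card I3 = card I"
    by (rule card_matching) (use I3 finI in auto)
  have "card (I - (I3 \<union> f3 ` I3)) \<le> 1"
    using I3(5) finI by (simp add: card_le_Suc0_iff_eq)
  then have c3: "card I \<le> 2 * card I3 + 1" using cI by simp
  have "card I3 \<le> self_similarity G"
  proof -
    define E where "E = (\<lambda>x. {x, f x}) ` I3"
    \<comment> \<open>The map follows the pairing \<open>f3\<close> at both ends of a matching
      edge.\<close>
    define h where "h = (\<lambda>z. if z \<in> I then f3 z else f (f3 (the_inv_into I f z)))"
    have h1: "h x = f3 x" if "x \<in> I3" for x using that I3(1) by (auto simp: h_def)
    have h2: "h (f x) = f (f3 x)" if "x \<in> I3" for x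
      using that I3(1) I(3,4) by (auto simp: h_def the_inv_into_f_f)
    have injf: "f x = f y \<longleftrightarrow> x = y" if "x \<in> I" "y \<in> I" for x y
      using I(3) that by (auto simp: inj_on_def)
    have ne: "x \<noteq> f y" "f y \<noteq> x" if "x \<in> I" "y \<in> I" for x y using that I(4) by auto
    have injE: "inj_on (\<lambda>x. {x, f x}) I3"
    proof (rule inj_onI)
      fix x y assume "x \<in> I3" "y \<in> I3" "{x, f x} = {y, f y}"
      then show "x = y" using ne[of x y] I3(1) by (auto simp: doubleton_eq_iff)
    qed
    have UE: "\<Union>E = I3 \<union> f ` I3" by (auto simp: E_def)
    have inj: "inj_on h (\<Union>E)"
    proof (rule inj_onI)
      fix a b assume ab: "a \<in> \<Union>E" "b \<in> \<Union>E" "h a = h b"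
      have f3I: "x \<in> I3 \<Longrightarrow> f3 x \<in> I" for x using I3(2) by auto
      have inj3: "x \<in> I3 \<Longrightarrow> y \<in> I3 \<Longrightarrow> f3 x = f3 y \<longleftrightarrow> x = y" for x y
        using I3(3) by (auto simp: inj_on_def)
      show "a = b"
        using ab f3I inj3 ne injf unfolding UE by (auto simp: h1 h2; metis)
    qed
    have him: "h ` {x, f x} = {f3 x, f (f3 x)}" if "x \<in> I3" for x
      using that by (simp add: h1 h2)
    have "card E \<le> self_similarity G"
    proof (rule self_similarity_ge[OF G inj])
      show "E \<subseteq> edges G" using I(5) I3(1) by (auto simp: E_def)
      show "(`) h ` E \<subseteq> edges G"
        using I(5) I3(2) him by (auto simp: E_def)
      have False if "x \<in> I3" "y \<in> I3" "{x, f x} = {f3 y, f (f3 y)}" for x y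
        using that I3(1,2,4) ne[of x "f3 y"] by (auto simp: doubleton_eq_iff)
      then show "E \<inter> (`) h ` E = {}"
        using him by (fastforce simp: E_def)
    qed
    then show ?thesis using card_image[OF injE] by (simp add: E_def)
  qed
  moreover have "card J \<le> 2 * self_similarity G + 2 * card I"
  proof -
    have "\<exists>z\<in>X. {z, y} \<in> edges G" if "y \<in> J" for y
    proof -
      obtain e where e: "e \<in> edges G" "y \<in> e"
        using \<open>y \<in> J\<close> by (auto simp: J_def V_def)
      then obtain z where z: "e = {y, z}" "y \<noteq> z"
        using edge_card[OF G e(1)] by (auto simp: card_2_iff)
      have "z \<in> V" using e z by (auto simp: V_def)
      then have "z \<in> X" using I(6)[of y z] that z e by (auto simp: J_def X_def)
      then show ?thesis using e z by (auto simp: insert_commute)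
    qed
    then obtain \<phi> where \<phi>: "\<And>y. y \<in> J \<Longrightarrow> \<phi> y \<in> X \<and> {\<phi> y, y} \<in> edges G" by metis
    \<comment> \<open>Leaves with the same centre are paired. Those left over have distinct centres,
      so there are at most \<open>card X\<close> of them.\<close>
    obtain I2 f2 where I2: "I2 \<subseteq> J" "f2 ` I2 \<subseteq> J" "inj_on f2 I2" "I2 \<inter> f2 ` I2 = {}"
      "\<And>x. x \<in> I2 \<Longrightarrow> \<phi> x = \<phi> (f2 x)"
      "\<And>x y. x \<in> J - (I2 \<union> f2 ` I2) \<Longrightarrow> y \<in> J - (I2 \<union> f2 ` I2) \<Longrightarrow> \<phi> x = \<phi> y \<Longrightarrow> x = y"
      by (rule maximal_matching[OF finJ, of "\<lambda>x y. \<phi> x = \<phi> y"]) (rule that)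
    have cJ2: "card (J - (I2 \<union> f2 ` I2)) + 2 * card I2 = card J"
      by (rule card_matching) (use I2 finJ in auto)
    have "card (J - (I2 \<union> f2 ` I2)) \<le> card X"
      by (rule card_inj_on_le[of \<phi>]) (use I2(6) \<phi> finX in \<open>auto simp: inj_on_def\<close>)
    also have "card X \<le> 2 * card I"
      unfolding X_def using card_Un_le[of I "f ` I"] card_image[OF I(3)] by simp
    finally have "card J \<le> 2 * card I + 2 * card I2" using cJ2 by simp
    moreover have "card I2 \<le> self_similarity G"
    proof -
      define E where "E = (\<lambda>y. {\<phi> y, y}) ` I2"
      define h where "h = (\<lambda>z. if z \<in> X then z else f2 z)"
      have JX: "J \<inter> X = {}" by (auto simp: J_def)
      have ne: "\<phi> y \<noteq> z" if "y \<in> J" "z \<in> J" for y z using \<phi> that JX by auto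
      have injE: "inj_on (\<lambda>y. {\<phi> y, y}) I2"
      proof (rule inj_onI)
        fix x y assume "x \<in> I2" "y \<in> I2" "{\<phi> x, x} = {\<phi> y, y}"
        then show "x = y" using ne[of x y] I2(1) by (auto simp: doubleton_eq_iff)
      qed
      have him: "h ` {\<phi> y, y} = {\<phi> (f2 y), f2 y}" if "y \<in> I2" for y
      proof -
        have "\<phi> y \<in> X" "y \<notin> X" using that \<phi> I2(1) JX by auto
        then have "h ` {\<phi> y, y} = {\<phi> y, f2 y}" by (auto simp: h_def)
        then show ?thesis using I2(5)[OF that] by simp
      qed
      have inj: "inj_on h (\<Union>E)"
      proof (rule inj_onI)
        fix a b assume "a \<in> \<Union>E" "b \<in> \<Union>E" and hab: "h a = h b"
        then have ab: "a \<in> X \<or> a \<in> I2" "b \<in> X \<or> b \<in> I2"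
          using \<phi> I2(1) by (auto simp: E_def)
        have "f2 x \<notin> X" if "x \<in> I2" for x using I2(2) JX that by auto
        then show "a = b"
          using ab hab JX I2(1,3) by (auto simp: h_def inj_on_def split: if_splits)
      qed
      have "card E \<le> self_similarity G"
      proof (rule self_similarity_ge[OF G inj])
        show "E \<subseteq> edges G" using \<phi> I2(1) by (auto simp: E_def)
        have "{\<phi> (f2 y), f2 y} \<in> edges G" if "y \<in> I2" for y
          using \<phi> I2(2) that by (simp add: image_subset_iff)
        then show "(`) h ` E \<subseteq> edges G"
          using him by (auto simp: E_def)
        have False if "x \<in> I2" "y \<in> I2" "{\<phi> x, x} = {\<phi> (f2 y), f2 y}" for x y
          using that I2(1,2,4) ne[of x "f2 y"] by (auto simp: doubleton_eq_iff)
        then show "E \<inter> (`) h ` E = {}"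
          using him by (fastforce simp: E_def)
      qed
      then show ?thesis using card_image[OF injE] by (simp add: E_def)
    qed
    ultimately show ?thesis by simp
  qed
  \<comment> \<open>With \<open>s\<close> the self-similarity,
    \<open>card V = card J + 2 * card I <= 2 * s + 4 * card I\<close> and
    \<open>card I <= 2 * s + 1\<close>; the constants of the claim are rounded up.\<close>
  ultimately show ?thesis using c3 cJ by (simp add: V_def)
qed

section \<open>Random permutations and random subsets\<close>

text \<open>\<open>A\<close> and its image have complements of equal size, and any bijection between
  these completes \<open>f\<close>. Isomorphisms of subgraphs thereby become permutations of all
  vertices, which can be counted.\<close>

lemma extend_to_permutation:
  assumes "finite U" "A \<subseteq> U" "f ` A \<subseteq> U" "inj_on f A"
  obtains \<sigma> where "\<sigma> permutes U" "\<And>x. x \<in> A \<Longrightarrow> \<sigma> x = f x"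
proof -
  have finA: "finite A" using assms(1,2) by (rule finite_subset[rotated])
  have "card (U - A) = card (U - f ` A)"
    using assms finA by (simp add: card_Diff_subset card_image)
  then obtain h where h: "bij_betw h (U - A) (U - f ` A)"
    using assms(1) finite_same_card_bij[of "U - A" "U - f ` A"] by auto
  define \<sigma> where "\<sigma> x = (if x \<in> A then f x else if x \<in> U then h x else x)" for x
  have 1: "bij_betw \<sigma> A (f ` A)"
    using assms(4) by (simp add: \<sigma>_def bij_betw_def cong: inj_on_cong image_cong)
  have 2: "bij_betw \<sigma> (U - A) (U - f ` A)"
    by (rule iffD1[OF bij_betw_cong h]) (simp add: \<sigma>_def)
  have "bij_betw \<sigma> (A \<union> (U - A)) (f ` A \<union> (U - f ` A))"
    by (rule bij_betw_combine[OF 1 2]) auto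
  moreover have "A \<union> (U - A) = U" "f ` A \<union> (U - f ` A) = U" using assms(2,3) by auto
  ultimately have "bij_betw \<sigma> U U" by simp
  then have "\<sigma> permutes U"
    by (rule bij_imp_permutes) (use assms(2) in \<open>auto simp: \<sigma>_def\<close>)
  then show ?thesis by (rule that) (simp add: \<sigma>_def)
qed

text \<open>Composition with a permutation carrying \<open>R\<close> to \<open>S'\<close> is a
  bijection between the two sets of permutations.\<close>

lemma card_permutations_image_eq:
  assumes U: "finite U" and S: "S \<subseteq> U" "S' \<subseteq> U" "R \<subseteq> U" "card R = card S" "card S' = card S"
  shows "card {\<pi>. \<pi> permutes U \<and> \<pi> ` S = R} = card {\<pi>. \<pi> permutes U \<and> \<pi> ` S = S'}"
proof -
  have fin: "finite R" "finite S'" using S U by (auto intro: finite_subset)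
  obtain f where f: "bij_betw f R S'"
    using finite_same_card_bij[OF fin] S by auto
  obtain \<tau> where \<tau>: "\<tau> permutes U" "\<And>x. x \<in> R \<Longrightarrow> \<tau> x = f x"
    by (rule extend_to_permutation[OF U S(3), of f])
       (use f S(2) in \<open>auto simp: bij_betw_def\<close>)
  have \<tau>R: "\<tau> ` R = S'" using \<tau>(2) f by (simp add: bij_betw_def cong: image_cong)
  have inj: "inj \<tau>" using \<tau>(1) by (rule permutes_inj)
  have "bij_betw (\<lambda>\<pi>. \<tau> \<circ> \<pi>) {\<pi>. \<pi> permutes U \<and> \<pi> ` S = R} {\<pi>. \<pi> permutes U \<and> \<pi> ` S = S'}"
  proof (rule bij_betwI[where g = "\<lambda>\<pi>. inv \<tau> \<circ> \<pi>"])
    show "(\<lambda>\<pi>. \<tau> \<circ> \<pi>) \<in> {\<pi>. \<pi> permutes U \<and> \<pi> ` S = R} \<rightarrow> {\<pi>. \<pi> permutes U \<and> \<pi> ` S = S'}"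
      using \<tau>(1) \<tau>R by (auto simp: permutes_compose image_comp[symmetric])
    have "inv \<tau> ` S' = R" using \<tau>R inj by (metis image_inv_f_f)
    then show "(\<lambda>\<pi>. inv \<tau> \<circ> \<pi>) \<in> {\<pi>. \<pi> permutes U \<and> \<pi> ` S = S'} \<rightarrow> {\<pi>. \<pi> permutes U \<and> \<pi> ` S = R}"
      using \<tau>(1) by (auto simp: permutes_compose permutes_inv image_comp[symmetric])
    show "inv \<tau> \<circ> (\<tau> \<circ> \<pi>) = \<pi>" for \<pi>
      using permutes_inv_o[OF \<tau>(1)] by (simp add: o_assoc)
    show "\<tau> \<circ> (inv \<tau> \<circ> \<pi>) = \<pi>" for \<pi>
      using permutes_inv_o[OF \<tau>(1)] by (simp add: o_assoc)
  qed
  then show ?thesis by (rule bij_betw_same_card)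
qed

text \<open>All images of \<open>S\<close> are equally likely, so a random permutation sends
  \<open>S\<close> to a uniform subset of its size. Cross-multiplying keeps the identity in the
  naturals.\<close>

lemma card_permutations_image:
  assumes U: "finite U" and S: "S \<subseteq> U"
  shows "card {\<pi>. \<pi> permutes U \<and> \<Phi> (\<pi> ` S)} * (card U choose card S) =
    fact (card U) * card {R. R \<subseteq> U \<and> card R = card S \<and> \<Phi> R}"
proof -
  define \<kappa> where "\<kappa> = card {\<pi>. \<pi> permutes U \<and> \<pi> ` S = S}"
  have finP: "finite {\<pi>. \<pi> permutes U}" using U by (rule finite_permutations)
  have finR: "finite {R. R \<subseteq> U \<and> card R = card S \<and> \<Psi> R}" for \<Psi>
    by (rule finite_subset[of _ "Pow U"]) (use U in auto)
  have count: "card {\<pi>. \<pi> permutes U \<and> \<Psi> (\<pi> ` S)} = \<kappa> * card {R. R \<subseteq> U \<and> card R = card S \<and> \<Psi> R}" for \<Psi>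
  proof -
    have "{\<pi>. \<pi> permutes U \<and> \<Psi> (\<pi> ` S)} =
       (\<Union>R\<in>{R. R \<subseteq> U \<and> card R = card S \<and> \<Psi> R}. {\<pi>. \<pi> permutes U \<and> \<pi> ` S = R})"
    proof (intro equalityI subsetI)
      fix \<pi> assume "\<pi> \<in> {\<pi>. \<pi> permutes U \<and> \<Psi> (\<pi> ` S)}"
      moreover from this have "\<pi> ` S \<subseteq> U" using S by (auto simp: permutes_in_image)
      moreover have "card (\<pi> ` S) = card S"
        using calculation(1) by (intro card_image) (auto intro: permutes_inj_on)
      ultimately show "\<pi> \<in> (\<Union>R\<in>{R. R \<subseteq> U \<and> card R = card S \<and> \<Psi> R}. {\<pi>. \<pi> permutes U \<and> \<pi> ` S = R})"
        by blast
    qed auto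
    also have "card \<dots> = (\<Sum>R\<in>{R. R \<subseteq> U \<and> card R = card S \<and> \<Psi> R}. card {\<pi>. \<pi> permutes U \<and> \<pi> ` S = R})"
      by (rule card_UN_disjoint) (use finR finP in \<open>auto intro: finite_subset[OF _ finP]\<close>)
    also have "\<dots> = (\<Sum>R\<in>{R. R \<subseteq> U \<and> card R = card S \<and> \<Psi> R}. \<kappa>)"
      unfolding \<kappa>_def by (intro sum.cong card_permutations_image_eq) (use U S in auto)
    finally show ?thesis by simp
  qed
  \<comment> \<open>The trivial predicate determines the common count
    \<open>\<kappa>\<close>.\<close>
  have "{\<pi>. \<pi> permutes U \<and> True} = {\<pi>. \<pi> permutes U}" by simp
  then have "fact (card U) = \<kappa> * (card U choose card S)"
    using count[of "\<lambda>_. True"] card_permutations[OF refl U] n_subsets[OF U, of "card S"] by simp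
  then show ?thesis using count[of \<Phi>] by simp
qed

section \<open>Log-concavity of binomial coefficients and negative correlation\<close>

lemma Suc_times_binomial_Suc: "Suc k * (n choose Suc k) = (n - k) * (n choose k)"
  by (simp only: binomial_absorption binomial_absorb_comp)

lemma binomial_log_concave_Suc:
  assumes "k \<le> l"
  shows "(n choose k) * (n choose Suc l) \<le> (n choose Suc k) * (n choose l)"
proof -
  have "(Suc k * Suc l) * ((n choose k) * (n choose Suc l)) =
      Suc k * (n choose k) * (Suc l * (n choose Suc l))" by (simp only: mult_ac)
  also have "\<dots> = (Suc k * (n - l)) * ((n choose k) * (n choose l))"
    by (simp only: Suc_times_binomial_Suc mult_ac)
  also have "\<dots> \<le> ((n - k) * Suc l) * ((n choose k) * (n choose l))"
  proof (rule mult_right_mono)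
    show "Suc k * (n - l) \<le> (n - k) * Suc l"
      using mult_mono[of "Suc k" "Suc l" "n - l" "n - k"] assms by (simp add: mult.commute)
  qed simp
  also have "\<dots> = (Suc k * (n choose Suc k)) * (Suc l * (n choose l))"
    by (simp only: Suc_times_binomial_Suc mult_ac)
  also have "\<dots> = (Suc k * Suc l) * ((n choose Suc k) * (n choose l))"
    by (simp only: mult_ac)
  finally show ?thesis by (rule mult_left_le_imp_le) simp
qed

text \<open>The ratio of \<open>n choose (j + t)\<close> to \<open>n choose j\<close> does not
  increase with \<open>j\<close>; it is compared at \<open>a\<close> and \<open>c\<close> without
  division.\<close>

lemma binomial_log_concave:
  assumes "a \<le> c"
  shows "(n choose a) * (n choose (c + t)) \<le> (n choose (a + t)) * (n choose c)"
  using assms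
proof (induction c rule: dec_induct)
  case (step c)
  show ?case
  proof (cases "c \<le> n")
    case True
    \<comment> \<open>The factor \<open>n choose c\<close> links the one-step inequality to the
      induction hypothesis and is cancelled at the end, being positive for \<open>c <= n\<close>.
      Beyond \<open>n\<close> the left side vanishes.\<close>
    have "(n choose c) * ((n choose a) * (n choose (Suc c + t))) =
        (n choose a) * ((n choose c) * (n choose Suc (c + t)))" by (simp add: mult_ac)
    also have "\<dots> \<le> (n choose a) * ((n choose Suc c) * (n choose (c + t)))"
      by (intro mult_left_mono binomial_log_concave_Suc) auto
    also have "\<dots> = ((n choose a) * (n choose (c + t))) * (n choose Suc c)" by (simp add: mult_ac)
    also have "\<dots> \<le> ((n choose (a + t)) * (n choose c)) * (n choose Suc c)"
      by (intro mult_right_mono step.IH) auto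
    also have "\<dots> = (n choose c) * ((n choose (a + t)) * (n choose Suc c))" by (simp add: mult_ac)
    finally show ?thesis by (rule mult_left_le_imp_le) (use True in simp)
  qed (simp add: binomial_eq_0)
qed simp

text \<open>The parts of \<open>R\<close> in \<open>S1\<close>, in \<open>S2\<close> and outside
  both are chosen independently. The conditional guards against truncated subtraction, which would
  turn an impossible choice into \<open>choose 0 = 1\<close>.\<close>

lemma card_subsets_two_intersections:
  fixes i j D :: nat
  assumes U: "finite U" and S: "S1 \<subseteq> U" "S2 \<subseteq> U" "S1 \<inter> S2 = {}"
  shows "card {R. R \<subseteq> U \<and> card R = D \<and> card (R \<inter> S1) = i \<and> card (R \<inter> S2) = j} =
    (card S1 choose i) * (card S2 choose j) *
      (if i + j \<le> D then (card U - card S1 - card S2) choose (D - (i + j)) else 0)"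
proof -
  define W where "W = U - S1 - S2"
  define \<R> where "\<R> = {R. R \<subseteq> U \<and> card R = D \<and> card (R \<inter> S1) = i \<and> card (R \<inter> S2) = j}"
  have fin: "finite S1" "finite S2" "finite W" using U S by (auto simp: W_def intro: finite_subset)
  have cW: "card W = card U - card S1 - card S2"
  proof -
    have "W = U - (S1 \<union> S2)" by (auto simp: W_def)
    then show ?thesis
      using fin S by (simp add: card_Diff_subset card_Un_disjoint)
  qed
  have split: "card R = card (R \<inter> S1) + card (R \<inter> S2) + card (R \<inter> W)" if "R \<subseteq> U" for R
  proof -
    have finR: "finite R" using that U by (rule finite_subset)
    have "R = (R \<inter> S1) \<union> (R \<inter> S2) \<union> (R \<inter> W)" using that by (auto simp: W_def)
    then have "card R = card ((R \<inter> S1) \<union> (R \<inter> S2) \<union> (R \<inter> W))" by simp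
    also have "\<dots> = card ((R \<inter> S1) \<union> (R \<inter> S2)) + card (R \<inter> W)"
      by (rule card_Un_disjoint) (use finR in \<open>auto simp: W_def\<close>)
    also have "card ((R \<inter> S1) \<union> (R \<inter> S2)) = card (R \<inter> S1) + card (R \<inter> S2)"
      by (rule card_Un_disjoint) (use finR S(3) in auto)
    finally show ?thesis .
  qed
  show ?thesis
  proof (cases "i + j \<le> D")
    case False
    have "R \<notin> \<R>" for R
      using split[of R] False by (auto simp: \<R>_def)
    then have "\<R> = {}" by blast
    then show ?thesis unfolding \<R>_def[symmetric] using False by simp
  next
    case True
    let ?T = "{X. X \<subseteq> S1 \<and> card X = i} \<times> {Y. Y \<subseteq> S2 \<and> card Y = j} \<times>
       {Z. Z \<subseteq> W \<and> card Z = D - (i + j)}"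
    have "bij_betw (\<lambda>R. (R \<inter> S1, R \<inter> S2, R \<inter> W)) \<R> ?T"
    proof (rule bij_betwI[where g = "\<lambda>(X, Y, Z). X \<union> Y \<union> Z"])
      show "(\<lambda>R. (R \<inter> S1, R \<inter> S2, R \<inter> W)) \<in> \<R> \<rightarrow> ?T"
        using split by (fastforce simp: \<R>_def)
      have rejoin: "(X \<union> Y \<union> Z) \<inter> S1 = X" "(X \<union> Y \<union> Z) \<inter> S2 = Y" "(X \<union> Y \<union> Z) \<inter> W = Z"
        "X \<union> Y \<union> Z \<subseteq> U"
        if "X \<subseteq> S1" "Y \<subseteq> S2" "Z \<subseteq> W" for X Y Z
        using that S unfolding W_def by blast+
      show "(\<lambda>(X, Y, Z). X \<union> Y \<union> Z) \<in> ?T \<rightarrow> \<R>"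
      proof (clarsimp simp: \<R>_def Pi_iff)
        fix X Y Z assume XYZ: "X \<subseteq> S1" "Y \<subseteq> S2" "Z \<subseteq> W" "card Z = D - (card X + card Y)"
          "i = card X" "j = card Y"
        show "X \<subseteq> U \<and> Y \<subseteq> U \<and> Z \<subseteq> U \<and> card (X \<union> Y \<union> Z) = D \<and>
          card ((X \<union> Y \<union> Z) \<inter> S1) = card X \<and> card ((X \<union> Y \<union> Z) \<inter> S2) = card Y"
          using rejoin[OF XYZ(1-3)] split[of "X \<union> Y \<union> Z"] XYZ(4-6) True by simp
      qed
      show "(case (R \<inter> S1, R \<inter> S2, R \<inter> W) of (X, Y, Z) \<Rightarrow> X \<union> Y \<union> Z) = R" if "R \<in> \<R>" for R
        using that by (auto simp: \<R>_def W_def)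
      show "(\<lambda>R. (R \<inter> S1, R \<inter> S2, R \<inter> W)) (case t of (X, Y, Z) \<Rightarrow> X \<union> Y \<union> Z) = t" if t: "t \<in> ?T" for t
      proof -
        obtain X Y Z where "t = (X, Y, Z)" by (cases t)
        then show ?thesis using t rejoin[of X Y Z] by simp
      qed
    qed
    then have "card \<R> = card ?T" by (rule bij_betw_same_card)
    also have "\<dots> = (card S1 choose i) * ((card S2 choose j) * (card W choose (D - (i + j))))"
      using fin by (simp only: card_cartesian_product n_subsets)
    finally show ?thesis using True cW by (simp add: \<R>_def mult.assoc)
  qed
qed

text \<open>Both products expand into sums over the same quadruples of indices, where the hypothesis
  applies termwise.\<close>

lemma sum_minor_nonpos:
  fixes h :: "'a \<Rightarrow> 'b \<Rightarrow> nat"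
  assumes "\<And>i i' j j'. i \<in> A \<Longrightarrow> i' \<in> A' \<Longrightarrow> j \<in> B \<Longrightarrow> j' \<in> B' \<Longrightarrow> h i j * h i' j' \<le> h i j' * h i' j"
  shows "(\<Sum>i\<in>A. \<Sum>j\<in>B. h i j) * (\<Sum>i\<in>A'. \<Sum>j\<in>B'. h i j) \<le>
     (\<Sum>i\<in>A. \<Sum>j\<in>B'. h i j) * (\<Sum>i\<in>A'. \<Sum>j\<in>B. h i j)"
proof -
  have "(\<Sum>i\<in>A. \<Sum>j\<in>B. h i j) * (\<Sum>i\<in>A'. \<Sum>j\<in>B'. h i j) =
     (\<Sum>i\<in>A. \<Sum>i'\<in>A'. \<Sum>j\<in>B. \<Sum>j'\<in>B'. h i j * h i' j')"
    by (simp only: sum_product)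
  also have "\<dots> \<le> (\<Sum>i\<in>A. \<Sum>i'\<in>A'. \<Sum>j\<in>B. \<Sum>j'\<in>B'. h i j' * h i' j)"
    by (intro sum_mono assms)
  also have "\<dots> = (\<Sum>i\<in>A. \<Sum>i'\<in>A'. \<Sum>j'\<in>B'. \<Sum>j\<in>B. h i j' * h i' j)"
    by (rule sum.cong[OF refl], rule sum.cong[OF refl], rule sum.swap)
  also have "\<dots> = (\<Sum>i\<in>A. \<Sum>j\<in>B'. h i j) * (\<Sum>i\<in>A'. \<Sum>j\<in>B. h i j)"
    by (simp only: sum_product)
  finally show ?thesis .
qed

text \<open>The joint distribution of the two intersection sizes has nonpositive \<open>2 \<times> 2\<close> minors, because
  binomial coefficients are log-concave; summing the minors gives negative correlation.\<close>

lemma negative_correlation: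
  fixes g D :: nat
  assumes U: "finite U" and S: "S1 \<subseteq> U" "S2 \<subseteq> U" "S1 \<inter> S2 = {}"
  shows "card {R. R \<subseteq> U \<and> card R = D \<and> g \<le> card (R \<inter> S1) \<and> g \<le> card (R \<inter> S2)} * (card U choose D) \<le>
    card {R. R \<subseteq> U \<and> card R = D \<and> g \<le> card (R \<inter> S1)} * card {R. R \<subseteq> U \<and> card R = D \<and> g \<le> card (R \<inter> S2)}"
proof -
  define h where "h i j = card {R. R \<subseteq> U \<and> card R = D \<and> card (R \<inter> S1) = i \<and> card (R \<inter> S2) = j}" for i j
  define n where "n = card U - card S1 - card S2"
  have h_eq: "h i j = (card S1 choose i) * (card S2 choose j) * (if i + j \<le> D then n choose (D - (i + j)) else 0)" for i j
    unfolding h_def n_def by (rule card_subsets_two_intersections[OF U S])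
  have minor: "h i j * h i' j' \<le> h i j' * h i' j" if "i \<le> i'" "j \<le> j'" for i i' j j'
  proof (cases "i' + j' \<le> D")
    case True
    \<comment> \<open>The choices inside \<open>S1\<close> and \<open>S2\<close> contribute equal
      factors to both products, so only the binomials for the complement of \<open>S1\<close> and
      \<open>S2\<close> differ.\<close>
    define t where "t = j' - j"
    define a where "a = D - (i' + j')"
    define c where "c = D - (i + j')"
    have eqs: "D - (i + j) = c + t" "D - (i' + j) = a + t" "i + j \<le> D" "i + j' \<le> D" "i' + j \<le> D"
      using that True by (simp_all add: t_def a_def c_def)
    have "(n choose a) * (n choose (c + t)) \<le> (n choose (a + t)) * (n choose c)"
      by (rule binomial_log_concave) (use that in \<open>simp add: a_def c_def\<close>)
    then have "((card S1 choose i) * (card S1 choose i') * (card S2 choose j) * (card S2 choose j')) *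
        ((n choose a) * (n choose (c + t))) \<le>
       ((card S1 choose i) * (card S1 choose i') * (card S2 choose j) * (card S2 choose j')) *
        ((n choose (a + t)) * (n choose c))" by (rule mult_left_mono) simp
    then show ?thesis
      unfolding h_eq using eqs True by (simp add: a_def[symmetric] c_def[symmetric] mult_ac)
  qed (simp add: h_eq)
  have fin: "finite {R. R \<subseteq> U \<and> P R}" for P
    by (rule finite_subset[of _ "Pow U"]) (use U in auto)
  have count: "card {R. R \<subseteq> U \<and> card R = D \<and> P (card (R \<inter> S1)) \<and> Q (card (R \<inter> S2))} =
     (\<Sum>i\<in>{i\<in>{..D}. P i}. \<Sum>j\<in>{j\<in>{..D}. Q j}. h i j)" for P Q
  proof -
    have le: "card (R \<inter> S) \<le> card R" if "R \<subseteq> U" for R S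
      using that U by (intro card_mono) (auto intro: finite_subset)
    have split: "{R. R \<subseteq> U \<and> card R = D \<and> P (card (R \<inter> S1)) \<and> Q (card (R \<inter> S2))} =
       (\<Union>(i, j)\<in>{i\<in>{..D}. P i} \<times> {j\<in>{..D}. Q j}.
          {R. R \<subseteq> U \<and> card R = D \<and> card (R \<inter> S1) = i \<and> card (R \<inter> S2) = j})"
      using le by auto
    have "card (\<Union>(i, j)\<in>{i\<in>{..D}. P i} \<times> {j\<in>{..D}. Q j}.
          {R. R \<subseteq> U \<and> card R = D \<and> card (R \<inter> S1) = i \<and> card (R \<inter> S2) = j}) = (\<Sum>(i, j)\<in>{i\<in>{..D}. P i} \<times> {j\<in>{..D}. Q j}. h i j)"
      unfolding h_def case_prod_unfold
      by (rule card_UN_disjoint) (use fin in auto)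
    then show ?thesis unfolding split by (simp only: sum.cartesian_product)
  qed
  define F where "F P Q = card {R. R \<subseteq> U \<and> card R = D \<and> P (card (R \<inter> S1)) \<and> Q (card (R \<inter> S2))}"
    for P Q :: "nat \<Rightarrow> bool"
  have Fcount: "F P Q = (\<Sum>i\<in>{i\<in>{..D}. P i}. \<Sum>j\<in>{j\<in>{..D}. Q j}. h i j)" for P Q
    unfolding F_def by (rule count)
  let ?hi = "\<lambda>i. g \<le> i" and ?lo = "\<lambda>i. i < g"
  have key: "F ?lo ?lo * F ?hi ?hi \<le> F ?lo ?hi * F ?hi ?lo"
    unfolding Fcount by (rule sum_minor_nonpos) (auto intro!: minor)
  have add1: "F P ?lo + F P ?hi = F P (\<lambda>_. True)" for P
    unfolding F_def
    by (subst card_Un_disjoint[symmetric]) (auto intro!: fin arg_cong[where f = card])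
  have add2: "F ?lo Q + F ?hi Q = F (\<lambda>_. True) Q" for Q
    unfolding F_def
    by (subst card_Un_disjoint[symmetric]) (auto intro!: fin arg_cong[where f = card])
  have total: "F (\<lambda>_. True) (\<lambda>_. True) = card U choose D"
    unfolding F_def using n_subsets[OF U, of D] by simp
  \<comment> \<open>Writing the total and both marginals as sums over the four cells and cancelling
    common terms leaves exactly \<open>key\<close>.\<close>
  have "F ?hi ?hi * F (\<lambda>_. True) (\<lambda>_. True) \<le> F ?hi (\<lambda>_. True) * F (\<lambda>_. True) ?hi"
    unfolding add1[symmetric] add2[symmetric] using key by (simp add: algebra_simps)
  then show ?thesis
    unfolding total by (simp add: F_def)
qed

section \<open>A lower bound for the hypergeometric tail\<close>

text \<open>Passing from \<open>k\<close> to \<open>Suc k\<close> multiplies the ratio of the two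
  binomials by \<open>(N - D - k) / (N - k)\<close>, which is at least \<open>1 - 2 * D / N\<close>
  as long as \<open>2 * k <= N\<close>.\<close>

lemma binomial_diff_ge:
  assumes "2 * k \<le> N" "0 < N" "2 * D \<le> N"
  shows "(1 - 2 * real D / real N) ^ k * real (N choose k) \<le> real ((N - D) choose k)"
proof -
  define y where "y = 1 - 2 * real D / real N"
  have "2 * real D \<le> real N" using assms(3) by linarith
  then have y: "0 \<le> y" using assms(2) by (simp add: y_def field_simps)
  have "y ^ k * real (N choose k) \<le> real ((N - D) choose k)"
    using assms(1)
  proof (induction k)
    case (Suc k)
    have "2 * real k \<le> real N" using Suc.prems by simp
    then have "y * real (N - k) \<le> real (N - D - k)"
    proof -
      have "real D * real N \<le> real D * (2 * (real N - real k))"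
        using \<open>2 * real k \<le> real N\<close> by (intro mult_left_mono) auto
      then have "real D \<le> 2 * real D / real N * (real N - real k)"
        using assms(2) by (simp add: field_simps)
      then have "y * (real N - real k) \<le> real N - real k - real D"
        by (simp add: y_def algebra_simps)
      then show ?thesis using Suc.prems by (simp add: of_nat_diff_real)
    qed
    then have step: "y ^ k * real (N choose k) * (y * real (N - k)) \<le> real ((N - D) choose k) * real (N - D - k)"
      using Suc y by (intro mult_mono) auto
    have absorb: "real (Suc k) * real (n choose Suc k) = real (n - k) * real (n choose k)" for n
      by (simp only: of_nat_mult[symmetric] Suc_times_binomial_Suc)
    have "real (Suc k) * (y ^ Suc k * real (N choose Suc k)) = y ^ Suc k * (real (Suc k) * real (N choose Suc k))"
      by (simp only: mult_ac)
    also have "\<dots> = y ^ k * real (N choose k) * (y * real (N - k))"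
      by (simp only: absorb power_Suc mult_ac)
    also note step
    also have "real ((N - D) choose k) * real (N - D - k) = real (Suc k) * real ((N - D) choose Suc k)"
      by (simp only: absorb mult_ac)
    finally have "real (Suc k) * (y ^ Suc k * real (N choose Suc k)) \<le>
        real (Suc k) * real ((N - D) choose Suc k)" .
    then show ?case by (rule mult_left_le_imp_le) simp
  qed simp
  then show ?thesis by (simp add: y_def)
qed

text \<open>Lowering the index from \<open>Suc k\<close> to \<open>k\<close> multiplies the binomial
  by \<open>(k + 1) / (N - k)\<close>, which is at least \<open>(D - g) / N\<close> for the indices
  that occur.\<close>

lemma binomial_lower_index_ge:
  assumes "j \<le> g" "g \<le> D" "0 < N"
  shows "(real (D - g) / real N) ^ j * real (N choose D) \<le> real (N choose (D - j))"
  using assms(1)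
proof (induction j)
  case (Suc j)
  define k where "k = D - Suc j"
  have k: "D - j = Suc k" "D - g \<le> Suc k" using Suc.prems assms(2) by (simp_all add: k_def)
  have "(real (D - g) / real N) ^ Suc j * real (N choose D) \<le> (real (D - g) / real N) * real (N choose Suc k)"
    using mult_left_mono[OF Suc.IH, of "real (D - g) / real N"] Suc.prems k(1) by (simp add: mult.assoc)
  also have "\<dots> \<le> (real (Suc k) / real N) * real (N choose Suc k)"
    using k(2) by (intro mult_right_mono divide_right_mono) auto
  also have "\<dots> = real (N - k) * real (N choose k) / real N"
    unfolding of_nat_mult[symmetric] Suc_times_binomial_Suc[symmetric] by (simp add: algebra_simps)
  also have "\<dots> \<le> real N * real (N choose k) / real N"
    by (intro divide_right_mono mult_right_mono) auto
  finally show ?case using assms(3) by (simp add: k_def)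
qed simp

text \<open>Only the term \<open>i = g\<close> is kept. Choosing the overlap contributes
  \<open>(D / g)^g\<close>, lowering the lower index from \<open>D\<close> to \<open>D - g\<close>
  contributes \<open>(D / (2 * N))^g\<close>, and avoiding the set elsewhere costs
  \<open>exp (- 4 * D^2 / N)\<close>, from \<open>exp (- 2 * z) <= 1 - z\<close> at
  \<open>z = 2 * D / N\<close>.\<close>

lemma hypergeometric_tail_ge:
  assumes g: "1 \<le> g" "2 * g \<le> D" and D: "4 * D \<le> N"
  shows "((real D)\<^sup>2 / (2 * real N * real g)) ^ g * exp (- 4 * (real D)\<^sup>2 / real N) \<le>
    real (\<Sum>i=g..D. (D choose i) * ((N - D) choose (D - i))) / real (N choose D)"
proof -
  define z where "z = 2 * real D / real N"
  have N: "0 < N" using g D by simp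
  have z: "0 \<le> z" "z \<le> 1 / 2"
  proof -
    have "4 * real D \<le> real N" using D by linarith
    then show "z \<le> 1 / 2" using N by (simp add: z_def field_simps)
  qed (simp add: z_def)
  have "exp (- 2 * z) \<le> 1 - z"
  proof -
    have "2 * z\<^sup>2 \<le> z" using mult_left_mono[OF z(2) z(1)] by (simp add: power2_eq_square)
    then have "- 2 * z \<le> ln (1 - z)" using ln_one_minus_pos_lower_bound[OF z] by linarith
    then have "exp (- 2 * z) \<le> exp (ln (1 - z))" by (simp only: exp_le_cancel_iff)
    then show ?thesis using z by simp
  qed
  then have "exp (- 2 * z) ^ D \<le> (1 - z) ^ D" by (rule power_mono) simp
  also have "(1 - z) ^ D \<le> (1 - z) ^ (D - g)"
    using z by (intro power_decreasing) auto
  finally have e: "exp (- 4 * (real D)\<^sup>2 / real N) \<le> (1 - z) ^ (D - g)"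
    by (simp add: exp_of_nat_mult[symmetric] z_def power2_eq_square field_simps)
  have "real D \<le> 2 * real (D - g)" using g by (simp add: of_nat_diff_real)
  then have "real D / (2 * real N) \<le> real (D - g) / real N"
    using N by (simp add: field_simps)
  then have "(real D / (2 * real N)) ^ g * real (N choose D) \<le> (real (D - g) / real N) ^ g * real (N choose D)"
    by (intro mult_right_mono power_mono) auto
  also have "\<dots> \<le> real (N choose (D - g))"
    by (rule binomial_lower_index_ge) (use g N in auto)
  finally have low: "(real D / (2 * real N)) ^ g * real (N choose D) \<le> real (N choose (D - g))" .
  have "exp (- 4 * (real D)\<^sup>2 / real N) * ((real D / (2 * real N)) ^ g * real (N choose D)) \<le>
      (1 - z) ^ (D - g) * real (N choose (D - g))"
    using z by (intro mult_mono e low) auto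
  also have "\<dots> \<le> real ((N - D) choose (D - g))"
    unfolding z_def using D N by (intro binomial_diff_ge) auto
  finally have a: "exp (- 4 * (real D)\<^sup>2 / real N) * ((real D / (2 * real N)) ^ g * real (N choose D)) \<le>
      real ((N - D) choose (D - g))" .
  have b: "(real D / real g) ^ g \<le> real (D choose g)"
    using g by (intro binomial_ge_n_over_k_pow_k) auto
  have "((real D)\<^sup>2 / (2 * real N * real g)) ^ g * exp (- 4 * (real D)\<^sup>2 / real N) * real (N choose D) =
     (real D / real g) ^ g * (exp (- 4 * (real D)\<^sup>2 / real N) * ((real D / (2 * real N)) ^ g * real (N choose D)))"
    by (simp add: power_divide power_mult_distrib power2_eq_square mult_ac)
  also have "\<dots> \<le> real (D choose g) * real ((N - D) choose (D - g))"
    by (intro mult_mono a b) auto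
  also have "\<dots> \<le> real (\<Sum>i=g..D. (D choose i) * ((N - D) choose (D - i)))"
    unfolding of_nat_mult[symmetric] of_nat_le_iff
    by (rule member_le_sum[of g]) (use g in auto)
  finally show ?thesis using D by (simp add: field_simps)
qed

section \<open>Graphs with small self-similarity\<close>

lemma card_supersets_le:
  assumes P: "finite P" and X: "X \<subseteq> P"
  shows "card {E. E \<subseteq> P \<and> card E = m \<and> X \<subseteq> E} \<le> (card P - card X) choose (m - card X)"
proof -
  have finX: "finite X" using X P by (rule finite_subset)
  have "card {E. E \<subseteq> P \<and> card E = m \<and> X \<subseteq> E} \<le> card {Y. Y \<subseteq> P - X \<and> card Y = m - card X}"
  proof (rule card_inj_on_le[of "\<lambda>E. E - X"])
    show "inj_on (\<lambda>E. E - X) {E. E \<subseteq> P \<and> card E = m \<and> X \<subseteq> E}"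
      by (rule inj_onI) auto
    show "(\<lambda>E. E - X) ` {E. E \<subseteq> P \<and> card E = m \<and> X \<subseteq> E} \<subseteq> {Y. Y \<subseteq> P - X \<and> card Y = m - card X}"
      using finX by (auto simp: card_Diff_subset)
    show "finite {Y. Y \<subseteq> P - X \<and> card Y = m - card X}"
      by (rule finite_subset[of _ "Pow P"]) (use P in auto)
  qed
  also have "\<dots> = (card P - card X) choose (m - card X)"
    using n_subsets[of "P - X" "m - card X"] P X finX by (simp add: card_Diff_subset)
  finally show ?thesis .
qed

text \<open>A random \<open>m\<close>-subset of \<open>N\<close> elements contains \<open>j\<close>
  given ones with probability the product of \<open>(m - i) / (N - i)\<close>, and each factor is at
  most \<open>m / N\<close>.\<close>

lemma binomial_diff_both_le:
  assumes "j \<le> m" "m \<le> N" "0 < N"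
  shows "real ((N - j) choose (m - j)) \<le> (real m / real N) ^ j * real (N choose m)"
  using assms(1)
proof (induction j)
  case (Suc j)
  define a b where "a = N - Suc j" and "b = m - Suc j"
  have ab: "N - j = Suc a" "m - j = Suc b" using Suc.prems assms(2) by (simp_all add: a_def b_def)
  have "real (Suc a) * real (a choose b) = real (Suc b) * real (Suc a choose Suc b)"
    by (simp only: of_nat_mult[symmetric] Suc_times_binomial_eq mult.commute)
  then have "real (a choose b) = real (Suc b) / real (Suc a) * real (Suc a choose Suc b)"
    by (simp add: field_simps)
  also have "\<dots> \<le> (real m / real N) * real (Suc a choose Suc b)"
  proof (rule mult_right_mono)
    have "real (Suc b) * real N \<le> real m * real (Suc a)"
    proof -
      have eqs: "real (Suc b) = real m - real j" "real (Suc a) = real N - real j"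
        using ab Suc.prems assms(2) by (simp_all flip: ab add: of_nat_diff)
      have "real j * real m \<le> real j * real N" using assms(2) by (intro mult_left_mono) auto
      then show ?thesis unfolding eqs by (simp add: algebra_simps)
    qed
    then show "real (Suc b) / real (Suc a) \<le> real m / real N"
      using assms(3) by (simp add: field_simps)
  qed simp
  also have "\<dots> \<le> (real m / real N) * ((real m / real N) ^ j * real (N choose m))"
    using Suc ab by (intro mult_left_mono) auto
  finally show ?case by (simp add: a_def b_def mult.assoc)
qed simp

text \<open>After division by \<open>fact s\<close> the left side is a single term of the
  exponential series.\<close>

lemma power_le_exp_times_fact: "real s ^ s \<le> exp (real s) * fact s"
proof -
  have "(\<Sum>n\<in>{s}. real s ^ n /\<^sub>R fact n) \<le> (\<Sum>n. real s ^ n /\<^sub>R fact n)"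
    by (rule sum_le_suminf[OF summable_exp_generic]) auto
  then have "real s ^ s / fact s \<le> exp (real s)" by (simp add: exp_def field_simps)
  then show ?thesis by (simp add: field_simps)
qed

lemma binomial_le_exp_power:
  assumes "0 < s"
  shows "real (N choose s) \<le> (exp 1 * real N / real s) ^ s"
proof -
  have e: "exp (real s) = exp 1 ^ s" by (simp add: exp_of_nat_mult[symmetric])
  have "real (N choose s) * fact s \<le> real N ^ s"
    using binomial_fact_pow[of N s] by (metis of_nat_fact of_nat_le_iff of_nat_mult of_nat_power)
  then have "real (N choose s) * fact s * exp (real s) \<le> real N ^ s * exp (real s)"
    by (rule mult_right_mono) simp
  then have "real (N choose s) * (exp (real s) * fact s) \<le> real N ^ s * exp 1 ^ s"
    unfolding e by (simp only: mult_ac)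
  moreover have "real (N choose s) * real s ^ s \<le> real (N choose s) * (exp (real s) * fact s)"
    by (intro mult_left_mono power_le_exp_times_fact) simp
  ultimately have "real (N choose s) * real s ^ s \<le> real N ^ s * exp 1 ^ s"
    by linarith
  then show ?thesis using assms by (simp add: power_divide power_mult_distrib field_simps)
qed

text \<open>Any witness can be cut down to exactly \<open>s\<close> edges and its injection extended
  to a permutation of \<open>V\<close>. A union bound then runs over these two choices, each of
  which forces \<open>2 * s\<close> given edges into the graph.\<close>

lemma card_graphs_with_large_self_similarity:
  fixes V :: "'a set"
  assumes V: "finite V"
  defines "P \<equiv> {e. e \<subseteq> V \<and> card e = 2}"
  defines "N \<equiv> card V choose 2"
  shows "card {E. E \<subseteq> P \<and> card E = m \<and> s \<le> self_similarity (V, E)} \<le>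
    fact (card V) * (N choose s) * ((N - 2 * s) choose (m - 2 * s))"
proof -
  define \<Sigma> where "\<Sigma> = {\<sigma>. \<sigma> permutes V}"
  define \<T> where "\<T> = {T. T \<subseteq> P \<and> card T = s}"
  define \<E> where "\<E> \<sigma> T = {E. E \<subseteq> P \<and> card E = m \<and> T \<union> (`) \<sigma> ` T \<subseteq> E \<and> T \<inter> (`) \<sigma> ` T = {}}" for \<sigma> T
  have finP: "finite P" unfolding P_def by (rule finite_subset[of _ "Pow V"]) (use V in auto)
  have cP: "card P = N" unfolding P_def N_def using V by (rule n_subsets)
  have fin\<Sigma>: "finite \<Sigma>" unfolding \<Sigma>_def using V by (rule finite_permutations)
  have fin\<T>: "finite \<T>" unfolding \<T>_def by (rule finite_subset[of _ "Pow P"]) (use finP in auto)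
  have c\<T>: "card \<T> = N choose s" unfolding \<T>_def cP[symmetric] using finP by (rule n_subsets)
  have fin\<E>: "finite (\<E> \<sigma> T)" for \<sigma> T
    unfolding \<E>_def by (rule finite_subset[of _ "Pow P"]) (use finP in auto)
  have \<E>: "card (\<E> \<sigma> T) \<le> (N - 2 * s) choose (m - 2 * s)" if "\<sigma> \<in> \<Sigma>" "T \<in> \<T>" for \<sigma> T
  proof (cases "\<E> \<sigma> T = {}")
    case False
    define X where "X = T \<union> (`) \<sigma> ` T"
    have disj: "T \<inter> (`) \<sigma> ` T = {}" and X: "X \<subseteq> P" using False by (auto simp: \<E>_def X_def)
    have T: "finite T" "card T = s"
      using that(2) finP by (auto simp: \<T>_def intro: finite_subset)
    have "inj_on ((`) \<sigma>) T"
      using that(1) by (intro inj_on_image_sets[of _ UNIV]) (auto simp: \<Sigma>_def permutes_inj)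
    then have "card X = 2 * s"
      unfolding X_def using T disj by (simp add: card_Un_disjoint card_image)
    moreover have "\<E> \<sigma> T \<subseteq> {E. E \<subseteq> P \<and> card E = m \<and> X \<subseteq> E}" by (auto simp: \<E>_def X_def)
    then have "card (\<E> \<sigma> T) \<le> card {E. E \<subseteq> P \<and> card E = m \<and> X \<subseteq> E}"
      by (rule card_mono[rotated]) (rule finite_subset[of _ "Pow P"], use finP in auto)
    ultimately show ?thesis using card_supersets_le[OF finP X, of m] cP by simp
  qed simp
  have "{E. E \<subseteq> P \<and> card E = m \<and> s \<le> self_similarity (V, E)} \<subseteq> (\<Union>\<sigma>\<in>\<Sigma>. \<Union>T\<in>\<T>. \<E> \<sigma> T)"
  proof
    fix E assume "E \<in> {E. E \<subseteq> P \<and> card E = m \<and> s \<le> self_similarity (V, E)}"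
    then have E: "E \<subseteq> P" "card E = m" "s \<le> self_similarity (V, E)" by auto
    have "finite_simple_graph (V, E)"
      using V E(1) by (auto simp: finite_simple_graph_def P_def)
    then obtain E0 f where f: "inj_on f (\<Union>E0)" "E0 \<subseteq> edges (V, E)" "(`) f ` E0 \<subseteq> edges (V, E)"
      "E0 \<inter> (`) f ` E0 = {}" "card E0 = self_similarity (V, E)"
      by (rule self_similarity_witness) (rule that)
    obtain T where T: "T \<subseteq> E0" "card T = s"
      using obtain_subset_with_card_n[of s E0] E(3) f(5) by metis
    have UE: "\<Union>E0 \<subseteq> V" using f(2) E(1) by (auto simp: P_def)
    have "f ` \<Union>E0 \<subseteq> V" unfolding image_Union using f(3) E(1) by (auto simp: P_def)
    then obtain \<sigma> where \<sigma>: "\<sigma> permutes V" "\<And>x. x \<in> \<Union>E0 \<Longrightarrow> \<sigma> x = f x"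
      by (rule extend_to_permutation[OF V UE _ f(1)]) (rule that)
    have "\<sigma> ` e = f ` e" if "e \<in> T" for e
      using that T(1) \<sigma>(2) by (intro image_cong) auto
    then have im: "(`) \<sigma> ` T = (`) f ` T" by (rule image_cong[OF refl])
    have fT: "(`) f ` T \<subseteq> (`) f ` E0" using T(1) by (rule image_mono)
    have "T \<subseteq> E" "(`) f ` T \<subseteq> E"
      using T(1) fT f(2,3) by (auto intro: order_trans)
    moreover have "T \<inter> (`) f ` T = {}"
      using Int_mono[OF T(1) fT] f(4) by simp
    ultimately have "E \<in> \<E> \<sigma> T" unfolding \<E>_def im using E(1,2) by simp
    moreover have "T \<in> \<T>" using T f(2) E(1) by (auto simp: \<T>_def)
    moreover have "\<sigma> \<in> \<Sigma>" using \<sigma>(1) by (simp add: \<Sigma>_def)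
    ultimately show "E \<in> (\<Union>\<sigma>\<in>\<Sigma>. \<Union>T\<in>\<T>. \<E> \<sigma> T)" by blast
  qed
  then have "card {E. E \<subseteq> P \<and> card E = m \<and> s \<le> self_similarity (V, E)} \<le> card (\<Union>\<sigma>\<in>\<Sigma>. \<Union>T\<in>\<T>. \<E> \<sigma> T)"
    by (rule card_mono[rotated]) (use fin\<Sigma> fin\<T> fin\<E> in auto)
  also have "\<dots> \<le> (\<Sum>\<sigma>\<in>\<Sigma>. card (\<Union>T\<in>\<T>. \<E> \<sigma> T))" using fin\<Sigma> by (rule card_UN_le)
  also have "\<dots> \<le> (\<Sum>\<sigma>\<in>\<Sigma>. \<Sum>T\<in>\<T>. card (\<E> \<sigma> T))" using fin\<T> by (intro sum_mono card_UN_le)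
  also have "\<dots> \<le> (\<Sum>\<sigma>\<in>\<Sigma>. \<Sum>T\<in>\<T>. (N - 2 * s) choose (m - 2 * s))" by (intro sum_mono \<E>)
  also have "\<dots> = fact (card V) * (N choose s) * ((N - 2 * s) choose (m - 2 * s))"
    using card_permutations[OF refl V] by (simp add: \<Sigma>_def c\<T>)
  finally show ?thesis .
qed

text \<open>With \<open>n = card V\<close>, the second condition on \<open>s\<close> makes
  \<open>exp 1 * m^2 / (N * s)\<close> at most \<open>exp (-1)\<close>, so bad graphs are a fraction
  of at most \<open>exp (n * ln n - s)\<close> of all graphs; the first condition makes this less
  than one.\<close>

lemma exists_graph_with_small_self_similarity:
  fixes V :: "'a set"
  assumes V: "finite V" "V \<noteq> {}"
  defines "N \<equiv> card V choose 2"
  assumes m: "1 \<le> m" "m \<le> N" and s: "real (card V) * ln (real (card V)) < real s"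
    "exp 2 * (real m)\<^sup>2 \<le> real N * real s"
  obtains E where "finite_simple_graph (V, E)" "card E = m" "self_similarity (V, E) < s"
proof -
  define P where "P = {e. e \<subseteq> V \<and> card e = 2}"
  define n where "n = card V"
  have n: "1 \<le> n" using V by (simp add: n_def Suc_le_eq card_gt_0_iff)
  have N: "0 < N" using m by simp
  have finP: "finite P" unfolding P_def by (rule finite_subset[of _ "Pow V"]) (use V in auto)
  have cP: "card P = N" unfolding P_def N_def using V(1) by (rule n_subsets)
  have "0 \<le> real n * ln (real n)" using n by simp
  then have s0: "0 < s" using s(1) by (simp add: n_def)
  have G: "finite_simple_graph (V, E)" if "E \<subseteq> P" for E
    using V that by (auto simp: finite_simple_graph_def P_def)
  have "\<exists>E. E \<subseteq> P \<and> card E = m \<and> self_similarity (V, E) < s"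
  proof (cases "2 * s \<le> m")
    case True
    have "fact (card V) \<le> real n ^ n" using fact_le_power[of n] by (simp add: n_def)
    also have "real n ^ n = exp (real n * ln (real n))"
      using n by (simp add: exp_of_nat_mult)
    finally have f: "fact (card V) \<le> exp (real n * ln (real n))" .
    have "exp 2 = exp 1 * exp (1 :: real)" by (simp flip: exp_add)
    then have "exp 1 * (real m)\<^sup>2 / (real N * real s) \<le> exp (-1)"
      using s(2) N s0 by (simp add: field_simps exp_minus)
    then have "(exp 1 * (real m)\<^sup>2 / (real N * real s)) ^ s \<le> exp (-1) ^ s"
      by (intro power_mono) auto
    then have e: "(exp 1 * (real m)\<^sup>2 / (real N * real s)) ^ s \<le> exp (- real s)"
      by (simp add: exp_of_nat_mult[symmetric])
    have "card {E. E \<subseteq> P \<and> card E = m \<and> s \<le> self_similarity (V, E)} \<le>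
        fact (card V) * (N choose s) * ((N - 2 * s) choose (m - 2 * s))"
      unfolding P_def N_def by (rule card_graphs_with_large_self_similarity[OF V(1)])
    then have "real (card {E. E \<subseteq> P \<and> card E = m \<and> s \<le> self_similarity (V, E)}) \<le>
        real (fact (card V) * (N choose s) * ((N - 2 * s) choose (m - 2 * s)))" by (rule of_nat_mono)
    also have "\<dots> = fact (card V) * real (N choose s) * real ((N - 2 * s) choose (m - 2 * s))"
      by (simp only: of_nat_mult of_nat_fact)
    also have "\<dots> \<le> fact (card V) * (exp 1 * real N / real s) ^ s * ((real m / real N) ^ (2 * s) * real (N choose m))"
      by (intro mult_mono binomial_le_exp_power binomial_diff_both_le s0 True m N) auto
    also have "\<dots> = fact (card V) * ((exp 1 * real N / real s) ^ s * (real m / real N) ^ (2 * s)) * real (N choose m)"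
      by (simp only: mult.assoc)
    also have "(exp 1 * real N / real s) ^ s * (real m / real N) ^ (2 * s) =
        (exp 1 * (real m)\<^sup>2 / (real N * real s)) ^ s"
    proof -
      have "exp 1 * real N / real s * (real m / real N)\<^sup>2 = exp 1 * (real m)\<^sup>2 / (real N * real s)"
        using N s0 by (simp add: power2_eq_square)
      then show ?thesis unfolding power_mult power_mult_distrib[symmetric] by simp
    qed
    also have "fact (card V) * (exp 1 * (real m)\<^sup>2 / (real N * real s)) ^ s * real (N choose m) \<le>
        exp (real n * ln (real n)) * exp (- real s) * real (N choose m)"
      by (intro mult_mono f e) auto
    also have "\<dots> = exp (real n * ln (real n) - real s) * real (N choose m)"
      by (simp add: exp_diff exp_minus field_simps)
    also have "\<dots> < 1 * real (N choose m)"
      using s(1) m by (intro mult_strict_right_mono) (auto simp: n_def)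
    finally have "card {E. E \<subseteq> P \<and> card E = m \<and> s \<le> self_similarity (V, E)} < card {E. E \<subseteq> P \<and> card E = m}"
      using n_subsets[OF finP, of m] cP by simp
    then have "{E. E \<subseteq> P \<and> card E = m \<and> s \<le> self_similarity (V, E)} \<noteq> {E. E \<subseteq> P \<and> card E = m}"
      by (rule less_not_refl2[THEN not_sym, THEN contrapos_nn]) simp
    then show ?thesis by (auto simp: not_le)
  next
    case False
    \<comment> \<open>When \<open>m < 2 * s\<close> every graph qualifies, since two edge-disjoint
      copies use twice as many edges.\<close>
    obtain E where E: "E \<subseteq> P" "card E = m" using obtain_subset_with_card_n[of m P] m(2) cP by metis
    obtain E0 f where f: "inj_on f (\<Union>E0)" "E0 \<subseteq> edges (V, E)" "(`) f ` E0 \<subseteq> edges (V, E)"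
      "E0 \<inter> (`) f ` E0 = {}" "card E0 = self_similarity (V, E)"
      by (rule self_similarity_witness[OF G[OF E(1)]]) (rule that)
    have finE: "finite E" using E(1) finP by (rule finite_subset)
    have "card E0 + card ((`) f ` E0) = card (E0 \<union> (`) f ` E0)"
      using f(2-4) finE by (intro card_Un_disjoint[symmetric]) (auto intro: finite_subset)
    also have "\<dots> \<le> m" unfolding E(2)[symmetric] using f(2,3) finE by (intro card_mono) auto
    finally have "2 * self_similarity (V, E) \<le> m"
      using card_image[OF inj_on_image_sets[OF f(1) order_refl]] f(5) by simp
    then show ?thesis using False E by (intro exI[of _ E]) simp
  qed
  then show ?thesis using that G by blast
qed

section \<open>Matching vertices with large overlaps\<close>

lemma card_subsets_large_intersection:
  assumes U: "finite U" and S: "S \<subseteq> U"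
  shows "card {R. R \<subseteq> U \<and> card R = D \<and> g \<le> card (R \<inter> S)} =
    (\<Sum>i=g..D. (card S choose i) * ((card U - card S) choose (D - i)))"
proof -
  have le: "card (R \<inter> S) \<le> card R" if "R \<subseteq> U" for R
    using that U by (intro card_mono) (auto intro: finite_subset)
  have fin: "finite {R. R \<subseteq> U \<and> P R}" for P
    by (rule finite_subset[of _ "Pow U"]) (use U in auto)
  \<comment> \<open>The vacuous condition on the empty set makes the count for two disjoint sets
    applicable.\<close>
  have "{R. R \<subseteq> U \<and> card R = D \<and> g \<le> card (R \<inter> S)} =
     (\<Union>i\<in>{g..D}. {R. R \<subseteq> U \<and> card R = D \<and> card (R \<inter> S) = i \<and> card (R \<inter> {}) = 0})"
    using le by auto
  also have "card \<dots> = (\<Sum>i\<in>{g..D}. card {R. R \<subseteq> U \<and> card R = D \<and> card (R \<inter> S) = i \<and> card (R \<inter> {}) = 0})"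
    by (rule card_UN_disjoint) (use fin in auto)
  also have "\<dots> = (\<Sum>i=g..D. (card S choose i) * ((card U - card S) choose (D - i)))"
    by (intro sum.cong refl, subst card_subsets_two_intersections[OF U S]) auto
  finally show ?thesis .
qed

lemma card_subsets_containing:
  assumes U: "finite U" and x: "x \<in> U"
  shows "card {R. R \<subseteq> U \<and> card R = D \<and> x \<in> R} * card U = D * (card U choose D)"
proof (cases D)
  case 0
  have empty: "{R. R \<subseteq> U \<and> card R = D \<and> x \<in> R} = {}"
    using 0 U by (auto dest: finite_subset)
  show ?thesis unfolding empty using 0 by simp
next
  case (Suc d)
  have "bij_betw (insert x) {R. R \<subseteq> U - {x} \<and> card R = d} {R. R \<subseteq> U \<and> card R = D \<and> x \<in> R}"
  proof (rule bij_betwI[where g = "\<lambda>R. R - {x}"])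
    show "insert x \<in> {R. R \<subseteq> U - {x} \<and> card R = d} \<rightarrow> {R. R \<subseteq> U \<and> card R = D \<and> x \<in> R}"
      using x U Suc by (auto simp: card_insert_if finite_subset[of _ "U - {x}"])
  qed (use Suc in auto)
  then have "card {R. R \<subseteq> U \<and> card R = D \<and> x \<in> R} = (card U - 1) choose d"
    using n_subsets[of "U - {x}" d] bij_betw_same_card U x by fastforce
  then show ?thesis
    using binomial_absorption[of d "card U"] Suc by (simp add: mult.commute)
qed

lemma card_subsets_meeting:
  assumes U: "finite U" and S: "S \<subseteq> U"
  shows "card {R. R \<subseteq> U \<and> card R = D \<and> R \<inter> S \<noteq> {}} * card U \<le> card S * D * (card U choose D)"
proof -
  have finS: "finite S" using S U by (rule finite_subset)
  have "{R. R \<subseteq> U \<and> card R = D \<and> R \<inter> S \<noteq> {}} = (\<Union>x\<in>S. {R. R \<subseteq> U \<and> card R = D \<and> x \<in> R})"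
    by auto
  then have "card {R. R \<subseteq> U \<and> card R = D \<and> R \<inter> S \<noteq> {}} \<le> (\<Sum>x\<in>S. card {R. R \<subseteq> U \<and> card R = D \<and> x \<in> R})"
    using card_UN_le[OF finS] by simp
  then have "card {R. R \<subseteq> U \<and> card R = D \<and> R \<inter> S \<noteq> {}} * card U \<le>
      (\<Sum>x\<in>S. card {R. R \<subseteq> U \<and> card R = D \<and> x \<in> R} * card U)"
    unfolding sum_distrib_right[symmetric] by (rule mult_right_mono) simp
  also have "\<dots> = (\<Sum>x\<in>S. D * (card U choose D))"
    by (intro sum.cong refl card_subsets_containing[OF U]) (use S in auto)
  finally show ?thesis by simp
qed

text \<open>Negative correlation requires disjoint sets. Sets \<open>R\<close> that avoid the common
  part are handled by the two differences; meeting the common part has probability at most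
  \<open>g * D / card U\<close> by a union bound.\<close>

lemma card_subsets_two_large_intersections:
  fixes U :: "'a set" and g D :: nat
  assumes U: "finite U" "U \<noteq> {}" "D \<le> card U"
    and S: "S1 \<subseteq> U" "S2 \<subseteq> U" "card S1 = D" "card S2 = D" "card (S1 \<inter> S2) \<le> g"
  defines "p \<equiv> real (\<Sum>i=g..D. (D choose i) * ((card U - D) choose (D - i))) / real (card U choose D)"
  shows "real (card {R. R \<subseteq> U \<and> card R = D \<and> g \<le> card (R \<inter> S1) \<and> g \<le> card (R \<inter> S2)}) \<le>
    (p\<^sup>2 + real g * real D / real (card U)) * real (card U choose D)"
proof -
  define H where "H = {R. R \<subseteq> U \<and> card R = D \<and> g \<le> card (R \<inter> (S1 - S2)) \<and> g \<le> card (R \<inter> (S2 - S1))}"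
  define M where "M = {R. R \<subseteq> U \<and> card R = D \<and> R \<inter> (S1 \<inter> S2) \<noteq> {}}"
  have fin: "finite {R. R \<subseteq> U \<and> P R}" for P
    by (rule finite_subset[of _ "Pow U"]) (use U in auto)
  have C: "0 < card U choose D" "0 < card U" using U by (auto simp: card_gt_0_iff)
  have pC: "real (card {R. R \<subseteq> U \<and> card R = D \<and> g \<le> card (R \<inter> S)}) = p * real (card U choose D)"
    if "S \<subseteq> U" "card S = D" for S
    using card_subsets_large_intersection[OF U(1) that(1), of D g] that(2) C(1) by (simp add: p_def)
  have p0: "0 \<le> p" unfolding p_def by (intro divide_nonneg_nonneg of_nat_0_le_iff)
  have le: "card {R. R \<subseteq> U \<and> card R = D \<and> g \<le> card (R \<inter> S')} \<le>
      card {R. R \<subseteq> U \<and> card R = D \<and> g \<le> card (R \<inter> S)}" if "S' \<subseteq> S" for S S'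
  proof (rule card_mono[OF fin], rule subsetI)
    fix R assume R: "R \<in> {R. R \<subseteq> U \<and> card R = D \<and> g \<le> card (R \<inter> S')}"
    then have "finite R" using U(1) by (auto intro: finite_subset)
    then have "card (R \<inter> S') \<le> card (R \<inter> S)"
      using that by (intro card_mono) auto
    then show "R \<in> {R. R \<subseteq> U \<and> card R = D \<and> g \<le> card (R \<inter> S)}" using R by simp
  qed
  have "{R. R \<subseteq> U \<and> card R = D \<and> g \<le> card (R \<inter> S1) \<and> g \<le> card (R \<inter> S2)} \<subseteq> H \<union> M"
  proof (intro subsetI)
    fix R assume R: "R \<in> {R. R \<subseteq> U \<and> card R = D \<and> g \<le> card (R \<inter> S1) \<and> g \<le> card (R \<inter> S2)}"
    show "R \<in> H \<union> M"
    proof (cases "R \<inter> (S1 \<inter> S2) = {}")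
      case True
      then have "R \<inter> (S1 - S2) = R \<inter> S1" "R \<inter> (S2 - S1) = R \<inter> S2" by auto
      then show ?thesis using R by (simp add: H_def)
    next
      case False
      then show ?thesis using R by (simp add: M_def)
    qed
  qed
  then have "card {R. R \<subseteq> U \<and> card R = D \<and> g \<le> card (R \<inter> S1) \<and> g \<le> card (R \<inter> S2)} \<le> card (H \<union> M)"
    by (rule card_mono[rotated]) (simp add: H_def M_def fin)
  also have "\<dots> \<le> card H + card M" by (rule card_Un_le)
  finally have 1: "real (card {R. R \<subseteq> U \<and> card R = D \<and> g \<le> card (R \<inter> S1) \<and> g \<le> card (R \<inter> S2)}) \<le>
      real (card H) + real (card M)" by linarith
  have "real (card H) \<le> p\<^sup>2 * real (card U choose D)"
  proof -
    have "card H * (card U choose D) \<le>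
      card {R. R \<subseteq> U \<and> card R = D \<and> g \<le> card (R \<inter> (S1 - S2))} *
      card {R. R \<subseteq> U \<and> card R = D \<and> g \<le> card (R \<inter> (S2 - S1))}"
      unfolding H_def by (rule negative_correlation) (use U S in auto)
    also have "\<dots> \<le> card {R. R \<subseteq> U \<and> card R = D \<and> g \<le> card (R \<inter> S1)} *
      card {R. R \<subseteq> U \<and> card R = D \<and> g \<le> card (R \<inter> S2)}"
      by (intro mult_mono le) auto
    finally have "real (card H) * real (card U choose D) \<le>
      real (card {R. R \<subseteq> U \<and> card R = D \<and> g \<le> card (R \<inter> S1)}) *
      real (card {R. R \<subseteq> U \<and> card R = D \<and> g \<le> card (R \<inter> S2)})"
      by (simp only: of_nat_mult[symmetric] of_nat_le_iff)
    also have "\<dots> = (p\<^sup>2 * real (card U choose D)) * real (card U choose D)"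
      using S by (simp add: pC power2_eq_square)
    finally show ?thesis using C by simp
  qed
  moreover have "real (card M) \<le> real g * real D / real (card U) * real (card U choose D)"
  proof -
    have "card M * card U \<le> card (S1 \<inter> S2) * D * (card U choose D)"
      unfolding M_def by (rule card_subsets_meeting) (use U S in auto)
    also have "\<dots> \<le> g * D * (card U choose D)"
      using S(5) by (intro mult_right_mono) auto
    finally have "real (card M) * real (card U) \<le> real g * real D * real (card U choose D)"
      by (simp only: of_nat_mult[symmetric] of_nat_le_iff)
    then show ?thesis using C by (simp add: field_simps)
  qed
  ultimately show ?thesis using 1 by (simp add: distrib_right)
qed

text \<open>First and second moments over a random permutation. Small common neighbourhoods make the events
  for two partners of the same vertex nearly independent. The end points of a maximal matching meet
  every good pair, so a small matching would force too large a second moment of the number of partners.\<close>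

lemma matching_of_large_overlaps:
  fixes U :: "'a set" and B :: "'b set" and Nb :: "'b \<Rightarrow> 'a set" and g D :: nat
  assumes U: "finite U" "U \<noteq> {}" "D \<le> card U" and B: "finite B"
    and Nb: "\<And>b. b \<in> B \<Longrightarrow> Nb b \<subseteq> U" "\<And>b. b \<in> B \<Longrightarrow> card (Nb b) = D"
    and codeg: "\<And>b b'. b \<in> B \<Longrightarrow> b' \<in> B \<Longrightarrow> b \<noteq> b' \<Longrightarrow> card (Nb b \<inter> Nb b') \<le> g"
  defines "p \<equiv> real (\<Sum>i=g..D. (D choose i) * ((card U - D) choose (D - i))) / real (card U choose D)"
  assumes q: "2 \<le> card B" and pq: "1 \<le> p * real (card B)"
    and pp: "real g * real D / real (card U) \<le> p\<^sup>2"
  obtains \<pi> I f where "\<pi> permutes U" "I \<subseteq> B" "f ` I \<subseteq> B" "inj_on f I" "I \<inter> f ` I = {}"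
    "\<And>b. b \<in> I \<Longrightarrow> g \<le> card (\<pi> ` Nb b \<inter> Nb (f b))" "real (card B) \<le> 96 * real (card I)"
proof -
  define \<P> where "\<P> = {\<pi>. \<pi> permutes U}"
  define n where "n = real (card \<P>)"
  define q where "q = real (card B)"
  define good where "good \<pi> b b' \<longleftrightarrow> b \<noteq> b' \<and> g \<le> card (\<pi> ` Nb b \<inter> Nb b')" for \<pi> b b'
  have finP: "finite \<P>" unfolding \<P>_def using U(1) by (rule finite_permutations)
  have n: "n = fact (card U)" "0 < n"
    unfolding n_def \<P>_def using card_permutations[OF refl U(1)] by simp_all
  have C: "0 < real (card U choose D)" using U by simp
  have q2: "2 \<le> q" using q by (simp add: q_def)
  have p0: "0 < p" using pq q2 zero_less_mult_pos2[of p q] by (simp add: q_def)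
  have prob: "real (card {\<pi>\<in>\<P>. \<Phi> (\<pi> ` Nb b)}) * real (card U choose D) =
      n * real (card {R. R \<subseteq> U \<and> card R = D \<and> \<Phi> R})" if "b \<in> B" for \<Phi> b
    using arg_cong[OF card_permutations_image[OF U(1) Nb(1)[OF that], of \<Phi>], of real]
    unfolding \<P>_def n(1) Nb(2)[OF that] by (simp only: of_nat_mult of_nat_fact mem_Collect_eq)
  have one: "real (card {\<pi>\<in>\<P>. good \<pi> b b'}) = p * n" if "b \<in> B" "b' \<in> B" "b \<noteq> b'" for b b'
    using prob[OF that(1), of "\<lambda>R. g \<le> card (R \<inter> Nb b')"]
      card_subsets_large_intersection[OF U(1) Nb(1)[OF that(2)], of D g] Nb(2)[OF that(2)] C that(3)
    by (simp add: p_def good_def field_simps)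
  have two: "real (card {\<pi>\<in>\<P>. good \<pi> b b' \<and> good \<pi> b b''}) \<le> 2 * p\<^sup>2 * n"
    if b: "b \<in> B" "b' \<in> B" "b'' \<in> B" "b' \<noteq> b''" for b b' b''
  proof (cases "b \<noteq> b' \<and> b \<noteq> b''")
    case True
    have "real (card {\<pi>\<in>\<P>. good \<pi> b b' \<and> good \<pi> b b''}) * real (card U choose D) =
       n * real (card {R. R \<subseteq> U \<and> card R = D \<and> g \<le> card (R \<inter> Nb b') \<and> g \<le> card (R \<inter> Nb b'')})"
      using prob[OF b(1), of "\<lambda>R. g \<le> card (R \<inter> Nb b') \<and> g \<le> card (R \<inter> Nb b'')"] True
      by (simp add: good_def)
    also have "\<dots> \<le> n * ((p\<^sup>2 + real g * real D / real (card U)) * real (card U choose D))"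
      unfolding p_def using n(2) b
      by (intro mult_left_mono card_subsets_two_large_intersections[OF U] Nb codeg) auto
    also have "\<dots> \<le> n * ((p\<^sup>2 + p\<^sup>2) * real (card U choose D))"
      using n(2) pp by (intro mult_left_mono mult_right_mono add_left_mono) auto
    also have "\<dots> = (2 * p\<^sup>2 * n) * real (card U choose D)" by simp
    finally show ?thesis using C by simp
  qed (use n(2) in \<open>auto simp: good_def\<close>)
  \<comment> \<open>Inverting the permutation exchanges the two members of a good pair, so bounds
    for outgoing partners transfer to incoming ones.\<close>
  have inv: "card {\<pi>\<in>\<P>. \<Phi> \<pi>} = card {\<pi>\<in>\<P>. \<Phi> (inv \<pi>)}" for \<Phi>
  proof (rule bij_betw_same_card)
    show "bij_betw inv {\<pi>\<in>\<P>. \<Phi> \<pi>} {\<pi>\<in>\<P>. \<Phi> (inv \<pi>)}"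
      by (rule bij_betwI[where g = inv]) (auto simp: \<P>_def permutes_inv permutes_inv_inv)
  qed
  have good_inv: "good (inv \<pi>) b b' \<longleftrightarrow> good \<pi> b' b" if "\<pi> \<in> \<P>" for \<pi> b b'
  proof -
    have \<pi>: "inj \<pi>" "\<pi> \<circ> inv \<pi> = id"
      using that by (auto simp: \<P>_def permutes_inj permutes_inv_o)
    have "card (inv \<pi> ` Nb b \<inter> Nb b') = card (\<pi> ` (inv \<pi> ` Nb b \<inter> Nb b'))"
      using \<pi>(1) by (intro card_image[symmetric]) (auto intro: inj_on_subset)
    also have "\<pi> ` (inv \<pi> ` Nb b \<inter> Nb b') = Nb b \<inter> \<pi> ` Nb b'"
      using \<pi> by (simp add: image_Int image_comp)
    finally show ?thesis by (auto simp: good_def Int_commute)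
  qed
  have two': "real (card {\<pi>\<in>\<P>. good \<pi> b' b \<and> good \<pi> b'' b}) \<le> 2 * p\<^sup>2 * n"
    if b: "b \<in> B" "b' \<in> B" "b'' \<in> B" "b' \<noteq> b''" for b b' b''
  proof -
    have "{\<pi>\<in>\<P>. good \<pi> b' b \<and> good \<pi> b'' b} = {\<pi>\<in>\<P>. good (inv \<pi>) b b' \<and> good (inv \<pi>) b b''}"
      using good_inv by auto
    then show ?thesis
      using inv[of "\<lambda>\<pi>. good \<pi> b b' \<and> good \<pi> b b''"] two[OF b] by simp
  qed
  have second_moment: "(\<Sum>\<pi>\<in>\<P>. \<Sum>b\<in>B. (real (card {b'\<in>B. G \<pi> b b'}))\<^sup>2) \<le> 3 * q ^ 3 * p\<^sup>2 * n"
    if G1: "\<And>b b'. b \<in> B \<Longrightarrow> b' \<in> B \<Longrightarrow> real (card {\<pi>\<in>\<P>. G \<pi> b b'}) \<le> p * n"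
      and G2: "\<And>b b' b''. b \<in> B \<Longrightarrow> b' \<in> B \<Longrightarrow> b'' \<in> B \<Longrightarrow> b' \<noteq> b'' \<Longrightarrow>
        real (card {\<pi>\<in>\<P>. G \<pi> b b' \<and> G \<pi> b b''}) \<le> 2 * p\<^sup>2 * n" for G
  proof -
    have "(\<Sum>\<pi>\<in>\<P>. \<Sum>b\<in>B. (real (card {b'\<in>B. G \<pi> b b'}))\<^sup>2) =
        (\<Sum>\<pi>\<in>\<P>. \<Sum>b\<in>B. \<Sum>b'\<in>B. \<Sum>b''\<in>B. of_bool (G \<pi> b b' \<and> G \<pi> b b''))"
    proof (intro sum.cong refl)
      fix \<pi> b
      have "real (card {b'\<in>B. G \<pi> b b'}) = (\<Sum>b'\<in>B. of_bool (G \<pi> b b'))"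
        using B by (simp add: of_bool_def sum.If_cases Int_def)
      then show "(real (card {b'\<in>B. G \<pi> b b'}))\<^sup>2 = (\<Sum>b'\<in>B. \<Sum>b''\<in>B. of_bool (G \<pi> b b' \<and> G \<pi> b b''))"
        by (simp add: power2_eq_square sum_product of_bool_conj)
    qed
    also have "\<dots> = (\<Sum>b\<in>B. \<Sum>b'\<in>B. \<Sum>b''\<in>B. \<Sum>\<pi>\<in>\<P>. of_bool (G \<pi> b b' \<and> G \<pi> b b''))"
      by (subst sum.swap, intro sum.cong refl, subst sum.swap, intro sum.cong refl, rule sum.swap)
    also have "\<dots> = (\<Sum>b\<in>B. \<Sum>b'\<in>B. \<Sum>b''\<in>B. real (card {\<pi>\<in>\<P>. G \<pi> b b' \<and> G \<pi> b b''}))"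
      using finP by (simp add: of_bool_def sum.If_cases Int_def)
    also have "\<dots> \<le> (\<Sum>b\<in>B. \<Sum>b'\<in>B. \<Sum>b''\<in>B. 2 * p\<^sup>2 * n + (if b'' = b' then p * n else 0))"
    proof (intro sum_mono)
      fix b b' b'' assume b: "b \<in> B" "b' \<in> B" "b'' \<in> B"
      show "real (card {\<pi>\<in>\<P>. G \<pi> b b' \<and> G \<pi> b b''}) \<le> 2 * p\<^sup>2 * n + (if b'' = b' then p * n else 0)"
        using G1[OF b(1,2)] G2[OF b] n(2) by (cases "b' = b''") (auto simp: add_increasing)
    qed
    also have "\<dots> = q * (q * (q * (2 * p\<^sup>2 * n) + p * n))"
      using B by (simp add: sum.distrib q_def)
    \<comment> \<open>The diagonal terms carry only one factor \<open>p\<close>; the hypothesis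
      \<open>1 <= p * card B\<close> supplies the second.\<close>
    also have "\<dots> \<le> q * (q * (q * (2 * p\<^sup>2 * n) + (p * q) * (p * n)))"
    proof -
      have "1 * (p * n) \<le> (p * q) * (p * n)"
        using pq p0 n(2) by (intro mult_right_mono) (auto simp: q_def)
      then show ?thesis using q2 by (intro mult_left_mono add_left_mono) auto
    qed
    also have "\<dots> = 3 * q ^ 3 * p\<^sup>2 * n"
      by (simp add: power2_eq_square power3_eq_cube algebra_simps)
    finally show ?thesis .
  qed
  define out where "out \<pi> b = real (card {b'\<in>B. good \<pi> b b'})" for \<pi> b
  define into where "into \<pi> b = real (card {b'\<in>B. good \<pi> b' b})" for \<pi> b
  have one_le: "real (card {\<pi>\<in>\<P>. good \<pi> b b'}) \<le> p * n" if "b \<in> B" "b' \<in> B" for b b'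
    using one[OF that] p0 n(2) by (cases "b = b'") (auto simp: good_def)
  have out2: "(\<Sum>\<pi>\<in>\<P>. \<Sum>b\<in>B. (out \<pi> b)\<^sup>2) \<le> 3 * q ^ 3 * p\<^sup>2 * n"
    unfolding out_def by (rule second_moment) (auto intro: one_le two)
  have into2: "(\<Sum>\<pi>\<in>\<P>. \<Sum>b\<in>B. (into \<pi> b)\<^sup>2) \<le> 3 * q ^ 3 * p\<^sup>2 * n"
    unfolding into_def by (rule second_moment) (auto intro: one_le two')
  have first: "q\<^sup>2 * p * n / 2 \<le> (\<Sum>\<pi>\<in>\<P>. \<Sum>b\<in>B. out \<pi> b)"
  proof -
    have "(\<Sum>\<pi>\<in>\<P>. \<Sum>b\<in>B. out \<pi> b) = (\<Sum>\<pi>\<in>\<P>. \<Sum>b\<in>B. \<Sum>b'\<in>B. of_bool (good \<pi> b b'))"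
      unfolding out_def using B by (simp add: of_bool_def sum.If_cases Int_def)
    also have "\<dots> = (\<Sum>b\<in>B. \<Sum>b'\<in>B. \<Sum>\<pi>\<in>\<P>. of_bool (good \<pi> b b'))"
      by (subst sum.swap, intro sum.cong refl, rule sum.swap)
    also have "\<dots> = (\<Sum>b\<in>B. \<Sum>b'\<in>B. real (card {\<pi>\<in>\<P>. good \<pi> b b'}))"
      using finP by (simp add: of_bool_def sum.If_cases Int_def)
    also have "\<dots> = (\<Sum>b\<in>B. \<Sum>b'\<in>B. p * n - (if b' = b then p * n else 0))"
    proof (intro sum.cong refl)
      fix b b' assume "b \<in> B" "b' \<in> B"
      then show "real (card {\<pi>\<in>\<P>. good \<pi> b b'}) = p * n - (if b' = b then p * n else 0)"
        using one[of b b'] by (auto simp: good_def)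
    qed
    also have "\<dots> = q * (q - 1) * (p * n)"
      using B by (simp add: sum_subtractf q_def algebra_simps)
    also have "\<dots> \<ge> q * (q / 2) * (p * n)"
      using q2 p0 n(2) by (intro mult_right_mono mult_left_mono) auto
    finally show ?thesis by (simp add: power2_eq_square algebra_simps)
  qed
  have "\<exists>\<pi>\<in>\<P>. \<exists>I f. I \<subseteq> B \<and> f ` I \<subseteq> B \<and> inj_on f I \<and> I \<inter> f ` I = {} \<and> (\<forall>b\<in>I. good \<pi> b (f b)) \<and>
    q \<le> 96 * real (card I)"
  proof (rule ccontr)
    assume contra: "\<not> ?thesis"
    \<comment> \<open>This weight in \<open>amgm\<close> balances the two contributions. A matching
      below \<open>q / 96\<close> has fewer than \<open>q / 48\<close> end points, and each
      contribution is then at most \<open>q^2 * p * n / 4\<close>, together the first moment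
      bound.\<close>
    define t where "t = 12 * q * p"
    have t: "0 < t" using q2 p0 by (simp add: t_def)
    have amgm: "x \<le> t + x\<^sup>2 / (4 * t)" for x
    proof -
      have "0 \<le> (x - 2 * t)\<^sup>2 / (4 * t)" using t by simp
      also have "\<dots> = t + x\<^sup>2 / (4 * t) - x" using t by (simp add: field_simps power2_eq_square)
      finally show ?thesis by simp
    qed
    have "(\<Sum>b\<in>B. out \<pi> b) < q / 48 * t + (\<Sum>b\<in>B. (out \<pi> b)\<^sup>2 + (into \<pi> b)\<^sup>2) / (2 * t)"
      if \<pi>: "\<pi> \<in> \<P>" for \<pi>
    proof -
      obtain I f where I: "I \<subseteq> B" "f ` I \<subseteq> B" "inj_on f I" "I \<inter> f ` I = {}"
        "\<And>b. b \<in> I \<Longrightarrow> good \<pi> b (f b)"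
        "\<And>b b'. b \<in> B - (I \<union> f ` I) \<Longrightarrow> b' \<in> B - (I \<union> f ` I) \<Longrightarrow> good \<pi> b b' \<Longrightarrow> b = b'"
        by (rule maximal_matching[OF B, of "good \<pi>"]) (rule that)
      have small: "96 * real (card I) < q" using contra \<pi> I(1-5) by (meson not_le)
      define X where "X = I \<union> f ` I"
      have X: "X \<subseteq> B" "finite X" using I(1,2) B by (auto simp: X_def intro: finite_subset)
      have "card X \<le> 2 * card I"
        unfolding X_def using card_Un_le[of I "f ` I"] card_image[OF I(3)] by simp
      then have cX: "real (card X) < q / 48" using small by linarith
      have "{(b, b'). b \<in> B \<and> b' \<in> B \<and> good \<pi> b b'} \<subseteq>
          (SIGMA b:X. {b'\<in>B. good \<pi> b b'}) \<union> (\<lambda>(b', b). (b, b')) ` (SIGMA b':X. {b\<in>B. good \<pi> b b'})"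
        using I(6) unfolding X_def[symmetric] by (force simp: good_def image_iff)
      then have "card {(b, b'). b \<in> B \<and> b' \<in> B \<and> good \<pi> b b'} \<le>
          card ((SIGMA b:X. {b'\<in>B. good \<pi> b b'}) \<union> (\<lambda>(b', b). (b, b')) ` (SIGMA b':X. {b\<in>B. good \<pi> b b'}))"
        by (rule card_mono[rotated]) (use B X in auto)
      also have "\<dots> \<le> card (SIGMA b:X. {b'\<in>B. good \<pi> b b'}) +
          card ((\<lambda>(b', b). (b, b')) ` (SIGMA b':X. {b\<in>B. good \<pi> b b'}))" by (rule card_Un_le)
      also have "card ((\<lambda>(b', b). (b, b')) ` (SIGMA b':X. {b\<in>B. good \<pi> b b'})) \<le>
          card (SIGMA b':X. {b\<in>B. good \<pi> b b'})"
        by (rule card_image_le) (use B X in auto)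
      finally have "card {(b, b'). b \<in> B \<and> b' \<in> B \<and> good \<pi> b b'} \<le>
          (\<Sum>b\<in>X. card {b'\<in>B. good \<pi> b b'}) + (\<Sum>b\<in>X. card {b'\<in>B. good \<pi> b' b})"
        using X B by simp
      moreover have "{(b, b'). b \<in> B \<and> b' \<in> B \<and> good \<pi> b b'} = (SIGMA b:B. {b'\<in>B. good \<pi> b b'})"
        by auto
      ultimately have "(\<Sum>b\<in>B. card {b'\<in>B. good \<pi> b b'}) \<le>
          (\<Sum>b\<in>X. card {b'\<in>B. good \<pi> b b'}) + (\<Sum>b\<in>X. card {b'\<in>B. good \<pi> b' b})"
        using B by simp
      then have "(\<Sum>b\<in>B. out \<pi> b) \<le> (\<Sum>b\<in>X. out \<pi> b) + (\<Sum>b\<in>X. into \<pi> b)"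
        unfolding out_def into_def by (simp only: of_nat_sum[symmetric] of_nat_add[symmetric] of_nat_le_iff)
      also have "\<dots> = (\<Sum>b\<in>X. out \<pi> b + into \<pi> b)" by (simp add: sum.distrib)
      also have "\<dots> \<le> (\<Sum>b\<in>X. t + (out \<pi> b + into \<pi> b)\<^sup>2 / (4 * t))"
        by (intro sum_mono amgm)
      also have "\<dots> \<le> (\<Sum>b\<in>X. t + ((out \<pi> b)\<^sup>2 + (into \<pi> b)\<^sup>2) / (2 * t))"
      proof (intro sum_mono add_left_mono)
        fix b
        have "(out \<pi> b + into \<pi> b)\<^sup>2 \<le> 2 * ((out \<pi> b)\<^sup>2 + (into \<pi> b)\<^sup>2)"
          using sum_squares_ge_zero[of "out \<pi> b - into \<pi> b" 0] by (simp add: power2_eq_square algebra_simps)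
        then have "(out \<pi> b + into \<pi> b)\<^sup>2 / (4 * t) \<le> 2 * ((out \<pi> b)\<^sup>2 + (into \<pi> b)\<^sup>2) / (4 * t)"
          using t by (intro divide_right_mono) auto
        also have "\<dots> = ((out \<pi> b)\<^sup>2 + (into \<pi> b)\<^sup>2) / (2 * t)"
          using t by (simp add: field_simps)
        finally show "(out \<pi> b + into \<pi> b)\<^sup>2 / (4 * t) \<le> ((out \<pi> b)\<^sup>2 + (into \<pi> b)\<^sup>2) / (2 * t)" .
      qed
      also have "\<dots> = real (card X) * t + (\<Sum>b\<in>X. (out \<pi> b)\<^sup>2 + (into \<pi> b)\<^sup>2) / (2 * t)"
        by (simp add: sum.distrib sum_divide_distrib add_divide_distrib)
      also have "\<dots> < q / 48 * t + (\<Sum>b\<in>B. (out \<pi> b)\<^sup>2 + (into \<pi> b)\<^sup>2) / (2 * t)"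
      proof (rule add_less_le_mono)
        show "real (card X) * t < q / 48 * t" using cX t by (rule mult_strict_right_mono)
        show "(\<Sum>b\<in>X. (out \<pi> b)\<^sup>2 + (into \<pi> b)\<^sup>2) / (2 * t) \<le> (\<Sum>b\<in>B. (out \<pi> b)\<^sup>2 + (into \<pi> b)\<^sup>2) / (2 * t)"
          using t X B by (intro divide_right_mono sum_mono2) auto
      qed
      finally show ?thesis .
    qed
    then have "(\<Sum>\<pi>\<in>\<P>. \<Sum>b\<in>B. out \<pi> b) <
        (\<Sum>\<pi>\<in>\<P>. q / 48 * t + (\<Sum>b\<in>B. (out \<pi> b)\<^sup>2 + (into \<pi> b)\<^sup>2) / (2 * t))"
      using finP n(2) by (intro sum_strict_mono) (auto simp: n_def)
    also have "\<dots> = n * (q / 48 * t) +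
        ((\<Sum>\<pi>\<in>\<P>. \<Sum>b\<in>B. (out \<pi> b)\<^sup>2) + (\<Sum>\<pi>\<in>\<P>. \<Sum>b\<in>B. (into \<pi> b)\<^sup>2)) / (2 * t)"
      by (simp add: sum.distrib sum_divide_distrib[symmetric] n_def)
    also have "\<dots> \<le> n * (q / 48 * t) + (3 * q ^ 3 * p\<^sup>2 * n + 3 * q ^ 3 * p\<^sup>2 * n) / (2 * t)"
      using t out2 into2 by (intro add_left_mono divide_right_mono add_mono) auto
    also have "\<dots> = q\<^sup>2 * p * n / 2"
      using q2 p0 unfolding t_def by (simp add: field_simps power2_eq_square power3_eq_cube)
    finally show False using first by simp
  qed
  then obtain \<pi> I f where "\<pi> \<in> \<P>" "I \<subseteq> B" "f ` I \<subseteq> B" "inj_on f I" "I \<inter> f ` I = {}"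
    "\<forall>b\<in>I. good \<pi> b (f b)" "q \<le> 96 * real (card I)"
    by (elim bexE exE conjE)
  then show ?thesis
    by (intro that[of \<pi> I f]) (auto simp: \<P>_def good_def q_def)
qed

text \<open>If \<open>E\<close> is maximal, every element of \<open>F\<close> lies in
  \<open>E\<close>, in its preimage or in its image, for otherwise it could be added. Each of these
  sets has at most \<open>card E\<close> elements.\<close>

lemma large_subset_disjoint_image:
  assumes F: "finite F" and inj: "inj_on h F" and ne: "\<And>x. x \<in> F \<Longrightarrow> h x \<noteq> x"
  obtains E where "E \<subseteq> F" "E \<inter> h ` E = {}" "card F \<le> 3 * card E"
proof -
  define \<E> where "\<E> = {E. E \<subseteq> F \<and> E \<inter> h ` E = {}}"
  have "finite \<E>" unfolding \<E>_def by (rule finite_subset[of _ "Pow F"]) (use F in auto)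
  moreover have "{} \<in> \<E>" by (simp add: \<E>_def)
  ultimately have "\<exists>E\<in>\<E>. {} \<subseteq> E \<and> (\<forall>E'\<in>\<E>. E \<subseteq> E' \<longrightarrow> E = E')"
    by (rule finite_has_maximal2)
  then obtain E where E: "E \<in> \<E>" and max: "\<forall>E'\<in>\<E>. E \<subseteq> E' \<longrightarrow> E = E'"
    by (elim bexE conjE)
  have EF: "E \<subseteq> F" "E \<inter> h ` E = {}" using E by (simp_all add: \<E>_def)
  have finE: "finite E" using EF(1) F by (rule finite_subset)
  have "x \<in> E \<union> {x\<in>F. h x \<in> E} \<union> h ` E" if x: "x \<in> F" for x
  proof (rule ccontr)
    assume contra: "x \<notin> E \<union> {x\<in>F. h x \<in> E} \<union> h ` E"
    then have "insert x E \<in> \<E>" using x EF ne[OF x] by (auto simp: \<E>_def)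
    then have "E = insert x E" using max by blast
    then show False using contra by blast
  qed
  then have "card F \<le> card (E \<union> {x\<in>F. h x \<in> E} \<union> h ` E)"
    using finE F by (intro card_mono) auto
  also have "\<dots> \<le> card E + card {x\<in>F. h x \<in> E} + card (h ` E)"
    using card_Un_le[of "E \<union> {x\<in>F. h x \<in> E}" "h ` E"] card_Un_le[of E "{x\<in>F. h x \<in> E}"] by simp
  also have "card {x\<in>F. h x \<in> E} \<le> card E"
    by (rule card_inj_on_le[of h]) (use inj finE in \<open>auto intro: inj_on_subset\<close>)
  also have "card (h ` E) \<le> card E" using finE by (rule card_image_le)
  finally show ?thesis using that EF by simp
qed

text \<open>A random permutation of \<open>U\<close> sends an edge to each of the
  \<open>k - 1\<close> other edges with probability one over \<open>card U choose 2\<close>. Some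
  permutation does at least as well as the average, and a third of its edges can be kept disjoint
  from their images.\<close>

lemma self_similarity_ge_density:
  assumes G: "finite_simple_graph G" and U: "finite U"
  defines "k \<equiv> card {e\<in>edges G. e \<subseteq> U}"
  shows "k * (k - 1) \<le> 3 * (card U choose 2) * self_similarity G"
proof -
  define E where "E = {e\<in>edges G. e \<subseteq> U}"
  define \<P> where "\<P> = {\<pi>. \<pi> permutes U}"
  define F where "F \<pi> = {e\<in>E. \<pi> ` e \<in> E \<and> \<pi> ` e \<noteq> e}" for \<pi>
  have finE: "finite E" using finite_edges[OF G] by (simp add: E_def)
  have finP: "finite \<P>" unfolding \<P>_def using U by (rule finite_permutations)
  have cP: "card \<P> = fact (card U)" unfolding \<P>_def by (rule card_permutations[OF refl U])
  have k: "k = card E" by (simp add: k_def E_def)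
  have e: "card {\<pi>\<in>\<P>. \<pi> ` e \<in> E \<and> \<pi> ` e \<noteq> e} * (card U choose 2) = fact (card U) * (k - 1)"
    if "e \<in> E" for e
  proof -
    have e: "e \<subseteq> U" "card e = 2" using that edge_card[OF G] by (auto simp: E_def)
    have "{R. R \<subseteq> U \<and> card R = card e \<and> R \<in> E \<and> R \<noteq> e} = E - {e}"
      using edge_card[OF G] e(2) by (auto simp: E_def)
    then have "card {R. R \<subseteq> U \<and> card R = card e \<and> R \<in> E \<and> R \<noteq> e} = k - 1"
      using that finE by (simp add: k)
    then show ?thesis
      using card_permutations_image[OF U e(1), of "\<lambda>R. R \<in> E \<and> R \<noteq> e"] e(2) by (simp add: \<P>_def)
  qed
  have "(\<Sum>\<pi>\<in>\<P>. card (F \<pi>)) = (\<Sum>\<pi>\<in>\<P>. \<Sum>e\<in>E. of_bool (\<pi> ` e \<in> E \<and> \<pi> ` e \<noteq> e))"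
    unfolding F_def using finE by (simp add: of_bool_def sum.If_cases Int_def)
  also have "\<dots> = (\<Sum>e\<in>E. \<Sum>\<pi>\<in>\<P>. of_bool (\<pi> ` e \<in> E \<and> \<pi> ` e \<noteq> e))" by (rule sum.swap)
  also have "\<dots> = (\<Sum>e\<in>E. card {\<pi>\<in>\<P>. \<pi> ` e \<in> E \<and> \<pi> ` e \<noteq> e})"
    using finP by (simp add: of_bool_def sum.If_cases Int_def)
  finally have "(\<Sum>\<pi>\<in>\<P>. card (F \<pi>)) * (card U choose 2) =
      (\<Sum>e\<in>E. card {\<pi>\<in>\<P>. \<pi> ` e \<in> E \<and> \<pi> ` e \<noteq> e} * (card U choose 2))"
    by (simp add: sum_distrib_right)
  also have "\<dots> = (\<Sum>e\<in>E. fact (card U) * (k - 1))"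
    by (intro sum.cong refl e)
  finally have total: "(\<Sum>\<pi>\<in>\<P>. card (F \<pi>) * (card U choose 2)) = (\<Sum>\<pi>\<in>\<P>. k * (k - 1))"
    by (simp add: sum_distrib_right k cP)
  have "\<P> \<noteq> {}" using cP finP by force
  have "\<exists>\<pi>\<in>\<P>. k * (k - 1) \<le> card (F \<pi>) * (card U choose 2)"
  proof (rule ccontr)
    assume "\<not> ?thesis"
    then have "(\<Sum>\<pi>\<in>\<P>. card (F \<pi>) * (card U choose 2)) < (\<Sum>\<pi>\<in>\<P>. k * (k - 1))"
      using finP \<open>\<P> \<noteq> {}\<close> by (intro sum_strict_mono) (auto simp: not_le)
    then show False using total by simp
  qed
  then obtain \<pi> where \<pi>: "\<pi> \<in> \<P>" "k * (k - 1) \<le> card (F \<pi>) * (card U choose 2)"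
    by blast
  have inj: "inj \<pi>" using \<pi>(1) by (simp add: \<P>_def permutes_inj)
  have finF: "finite (F \<pi>)" using finE by (simp add: F_def)
  have injF: "inj_on ((`) \<pi>) (F \<pi>)" by (rule inj_on_image_sets[of _ UNIV]) (use inj in auto)
  have neF: "\<pi> ` e \<noteq> e" if "e \<in> F \<pi>" for e using that by (simp add: F_def)
  obtain E' where E': "E' \<subseteq> F \<pi>" "E' \<inter> (`) \<pi> ` E' = {}" "card (F \<pi>) \<le> 3 * card E'"
    by (rule large_subset_disjoint_image[OF finF injF neF]) (assumption, rule that)
  have "card E' \<le> self_similarity G"
  proof (rule self_similarity_ge[OF G])
    show "inj_on \<pi> (\<Union>E')" using inj by (rule inj_on_subset) simp
  qed (use E'(1,2) in \<open>auto simp: F_def E_def\<close>)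
  then have "card (F \<pi>) \<le> 3 * self_similarity G" using E'(3) by simp
  then have "card (F \<pi>) * (card U choose 2) \<le> 3 * self_similarity G * (card U choose 2)"
    by (rule mult_right_mono) simp
  with \<pi>(2) have "k * (k - 1) \<le> 3 * self_similarity G * (card U choose 2)" by (rule order_trans)
  then show ?thesis by (simp only: mult_ac)
qed

text \<open>In a cut with the most crossing edges, moving one vertex across gains nothing, so at
  least half of its neighbours are on the other side.\<close>

lemma max_cut:
  fixes adj :: "'a \<Rightarrow> 'a \<Rightarrow> bool"
  assumes U: "finite U" and sym: "\<And>x y. adj x y \<longleftrightarrow> adj y x" and irrefl: "\<And>x. \<not> adj x x"
  obtains P where "P \<subseteq> U"
    "\<And>v. v \<in> U \<Longrightarrow> card {w\<in>U. adj v w} \<le> 2 * card {w\<in>U. adj v w \<and> (w \<in> P) \<noteq> (v \<in> P)}"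
proof -
  \<comment> \<open>Pairs ordered from \<open>P\<close> outwards count each crossing edge
    once.\<close>
  define cut where "cut P = {(x, y). x \<in> P \<and> y \<in> U - P \<and> adj x y}" for P
  have fin: "finite (cut P)" if "P \<subseteq> U" for P
    by (rule finite_subset[of _ "U \<times> U"]) (use that U in \<open>auto simp: cut_def\<close>)
  have "Max ((\<lambda>P. card (cut P)) ` Pow U) \<in> (\<lambda>P. card (cut P)) ` Pow U"
    by (rule Max_in) (use U in auto)
  then obtain P where Pm: "Max ((\<lambda>P. card (cut P)) ` Pow U) = card (cut P)" and P: "P \<in> Pow U"
    by (rule imageE)
  have max: "card (cut P') \<le> card (cut P)" if "P' \<subseteq> U" for P'
    unfolding Pm[symmetric] using that U by (intro Max_ge) auto
  have PU: "P \<subseteq> U" using P by simp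
  have exchange: "card Y \<le> card X"
    if X: "X \<subseteq> cut P" and Y: "Y \<inter> (cut P - X) = {}" "cut P' = (cut P - X) \<union> Y" and P': "P' \<subseteq> U" for X Y P'
  proof -
    have finXY: "finite X" "finite Y"
      using X fin[OF PU] Y(2) fin[OF P'] by (auto intro: finite_subset)
    have "card (cut P - X) + card Y = card (cut P')"
      unfolding Y(2) using finXY fin[OF PU] Y(1) by (subst card_Un_disjoint) auto
    moreover have "card (cut P - X) + card X = card (cut P)"
      using card_Diff_subset[OF finXY(1) X] card_mono[OF fin[OF PU] X] by simp
    ultimately show ?thesis using max[OF P'] by simp
  qed
  show ?thesis
  proof (rule that[OF PU])
    fix v assume v: "v \<in> U"
    define N where "N = {w\<in>U. adj v w}"
    have finN: "finite N" using U by (simp add: N_def)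
    have split: "card N = card (N \<inter> P) + card (N - P)"
      using finN by (rule card_Int_Diff)
    have c1: "card ({v} \<times> (N - P)) = card (N - P)" "card ((N \<inter> P) \<times> {v}) = card (N \<inter> P)"
      by (simp_all add: card_cartesian_product)
    show "card {w\<in>U. adj v w} \<le> 2 * card {w\<in>U. adj v w \<and> (w \<in> P) \<noteq> (v \<in> P)}"
    proof (cases "v \<in> P")
      case True
      have "card ((N \<inter> P) \<times> {v}) \<le> card ({v} \<times> (N - P))"
      proof (rule exchange[where P' = "P - {v}"])
        show "cut (P - {v}) = (cut P - {v} \<times> (N - P)) \<union> (N \<inter> P) \<times> {v}"
          using True v PU sym irrefl by (auto simp: cut_def N_def)
      qed (use True PU in \<open>auto simp: cut_def N_def\<close>)
      moreover have "{w\<in>U. adj v w \<and> (w \<in> P) \<noteq> (v \<in> P)} = N - P" using True by (auto simp: N_def)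
      ultimately show ?thesis using split c1 unfolding N_def[symmetric] by simp
    next
      case False
      have "card ({v} \<times> (N - P)) \<le> card ((N \<inter> P) \<times> {v})"
      proof (rule exchange[where P' = "insert v P"])
        show "cut (insert v P) = (cut P - (N \<inter> P) \<times> {v}) \<union> {v} \<times> (N - P)"
          using False v PU sym irrefl by (auto simp: cut_def N_def)
      qed (use False v PU sym in \<open>auto simp: cut_def N_def\<close>)
      moreover have "{w\<in>U. adj v w \<and> (w \<in> P) \<noteq> (v \<in> P)} = N \<inter> P" using False by (auto simp: N_def)
      ultimately show ?thesis using split c1 unfolding N_def[symmetric] by simp
    qed
  qed
qed

text \<open>The isomorphism is \<open>f\<close> on \<open>B\<close> and \<open>\<pi>\<close>
  elsewhere. An overlap at \<open>b\<close> consists of edges at \<open>b\<close> that become edges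
  at \<open>f b\<close>, and these are new because \<open>f\<close> maps \<open>I\<close> off
  itself.\<close>

lemma self_similarity_ge_overlaps:
  assumes G: "finite_simple_graph G" and B: "finite B" "B \<inter> Q = {}"
    and Nb: "\<And>b. b \<in> B \<Longrightarrow> Nb b \<subseteq> Q" "\<And>b a. b \<in> B \<Longrightarrow> a \<in> Nb b \<Longrightarrow> {b, a} \<in> edges G"
    and Q: "finite Q" and \<pi>: "inj \<pi>"
    and I: "I \<subseteq> B" "f ` I \<subseteq> B" "inj_on f I" "I \<inter> f ` I = {}"
    and overlap: "\<And>b. b \<in> I \<Longrightarrow> g \<le> card (\<pi> ` Nb b \<inter> Nb (f b))"
  shows "card I * g \<le> self_similarity G"
proof -
  define A where "A b = {a\<in>Nb b. \<pi> a \<in> Nb (f b)}" for b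
  define S where "S = (SIGMA b:I. A b)"
  define E where "E = (\<lambda>(b, a). {b, a}) ` S"
  define h where "h z = (if z \<in> B then f z else \<pi> z)" for z
  have finI: "finite I" using I(1) B(1) by (rule finite_subset)
  have S: "b \<in> I" "b \<in> B" "f b \<in> B" "a \<in> Q" "a \<notin> B" "\<pi> a \<in> Q" "\<pi> a \<notin> B" "{b, a} \<in> edges G"
    "{f b, \<pi> a} \<in> edges G" if "(b, a) \<in> S" for b a
  proof -
    show b: "b \<in> I" "b \<in> B" "f b \<in> B" using that I by (auto simp: S_def)
    have a: "a \<in> Nb b" "\<pi> a \<in> Nb (f b)" using that by (auto simp: S_def A_def)
    show "a \<in> Q" "a \<notin> B" "\<pi> a \<in> Q" "\<pi> a \<notin> B" "{b, a} \<in> edges G" "{f b, \<pi> a} \<in> edges G"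
      using a b Nb B(2) by blast+
  qed
  have finA: "finite (A b)" if "b \<in> I" for b
    using that I(1) Nb(1) Q by (auto simp: A_def intro: finite_subset[of _ Q])
  have "card I * g = (\<Sum>b\<in>I. g)" by simp
  also have "\<dots> \<le> (\<Sum>b\<in>I. card (A b))"
  proof (rule sum_mono)
    fix b assume b: "b \<in> I"
    have "\<pi> ` Nb b \<inter> Nb (f b) = \<pi> ` A b" by (auto simp: A_def)
    then have "card (\<pi> ` Nb b \<inter> Nb (f b)) = card (A b)"
      using card_image[OF inj_on_subset[OF \<pi>], of "A b"] by simp
    then show "g \<le> card (A b)" using overlap[OF b] by simp
  qed
  also have "\<dots> = card S" unfolding S_def using finI finA by simp
  also have "card S = card E"
  proof -
    have "inj_on (\<lambda>(b, a). {b, a}) S"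
    proof (rule inj_onI, clarify)
      fix b a b' a' assume "(b, a) \<in> S" "(b', a') \<in> S" "{b, a} = {b', a'}"
      then show "b = b' \<and> a = a'" using S(2,5)[of b a] S(2,5)[of b' a'] by (auto simp: doubleton_eq_iff)
    qed
    then show ?thesis unfolding E_def by (rule card_image[symmetric])
  qed
  also have "card E \<le> self_similarity G"
  proof (rule self_similarity_ge[OF G, of h])
    have him: "h ` {b, a} = {f b, \<pi> a}" if "(b, a) \<in> S" for b a
      using S[OF that] by (auto simp: h_def)
    show "E \<subseteq> edges G" using S(8) by (auto simp: E_def)
    show "(`) h ` E \<subseteq> edges G"
    proof
      fix e assume "e \<in> (`) h ` E"
      then obtain b a where "(b, a) \<in> S" "e = h ` {b, a}" by (auto simp: E_def)
      then show "e \<in> edges G" using him S(9) by simp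
    qed
    show "E \<inter> (`) h ` E = {}"
    proof (rule ccontr)
      assume "E \<inter> (`) h ` E \<noteq> {}"
      then obtain b a b' a' where ba: "(b, a) \<in> S" "(b', a') \<in> S" "{b, a} = h ` {b', a'}"
        by (auto simp: E_def)
      then have "{b, a} = {f b', \<pi> a'}" using him by simp
      then have "b = f b'" using S[OF ba(1)] S[OF ba(2)] by (auto simp: doubleton_eq_iff)
      then show False using S(1)[OF ba(1)] S(1)[OF ba(2)] I(4) by auto
    qed
    show "inj_on h (\<Union>E)"
    proof (rule inj_onI)
      fix x y assume xy: "x \<in> \<Union>E" "y \<in> \<Union>E" and hxy: "h x = h y"
      \<comment> \<open>Globally \<open>h\<close> need not be injective. On the end points of
        \<open>E\<close>, an image in \<open>B\<close> comes from \<open>I\<close> through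
        \<open>f\<close> and any other image from \<open>Q\<close> through
        \<open>\<pi>\<close>.\<close>
      have in_B: "z \<in> I \<and> h z = f z" if z: "z \<in> \<Union>E" "h z \<in> B" for z
      proof -
        obtain b a where "(b, a) \<in> S" "z = b \<or> z = a" using z(1) by (auto simp: E_def)
        then show ?thesis using S[of b a] z(2) by (auto simp: h_def)
      qed
      have notin_B: "h z = \<pi> z" if z: "z \<in> \<Union>E" "h z \<notin> B" for z
      proof -
        obtain b a where "(b, a) \<in> S" "z = b \<or> z = a" using z(1) by (auto simp: E_def)
        then show ?thesis using S[of b a] z(2) by (auto simp: h_def)
      qed
      show "x = y"
      proof (cases "h x \<in> B")
        case True
        then show ?thesis using in_B[OF xy(1)] in_B[OF xy(2)] hxy inj_onD[OF I(3), of x y] by simp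
      next
        case False
        then show ?thesis using notin_B[OF xy(1)] notin_B[OF xy(2)] hxy injD[OF \<pi>, of x y] by simp
      qed
    qed
  qed
  finally show ?thesis .
qed

text \<open>Pairs of vertices whose neighbourhoods already overlap in \<open>g\<close> vertices are matched with the
  identity permutation; the remaining vertices then satisfy the hypothesis on common neighbourhoods.\<close>

lemma self_similarity_ge_neighbourhoods:
  fixes U :: "'a set" and g D :: nat
  assumes G: "finite_simple_graph G" and U: "finite U" "U \<noteq> {}" "D \<le> card U"
    and BQ: "finite B" "Q \<subseteq> U" "B \<inter> Q = {}"
    and deg: "\<And>b. b \<in> B \<Longrightarrow> D \<le> card {w\<in>Q. {b, w} \<in> edges G}"
  defines "p \<equiv> real (\<Sum>i=g..D. (D choose i) * ((card U - D) choose (D - i))) / real (card U choose D)"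
  assumes q: "4 \<le> card B" and pq: "2 \<le> p * real (card B)"
    and pp: "real g * real D / real (card U) \<le> p\<^sup>2"
  shows "card B * g \<le> 192 * self_similarity G"
proof -
  have "\<exists>N. N \<subseteq> {w\<in>Q. {b, w} \<in> edges G} \<and> card N = D" if "b \<in> B" for b
    using obtain_subset_with_card_n[OF deg[OF that]] by blast
  then obtain Nb where Nb0: "\<forall>b\<in>B. Nb b \<subseteq> {w\<in>Q. {b, w} \<in> edges G} \<and> card (Nb b) = D"
    by metis
  have Nb: "Nb b \<subseteq> Q" "card (Nb b) = D" "a \<in> Nb b \<Longrightarrow> {b, a} \<in> edges G" if "b \<in> B" for b a
    using Nb0 that by blast+
  have finQ: "finite Q" using BQ(2) U(1) by (rule finite_subset)
  obtain I f where I: "I \<subseteq> B" "f ` I \<subseteq> B" "inj_on f I" "I \<inter> f ` I = {}"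
    "\<And>b. b \<in> I \<Longrightarrow> g \<le> card (Nb b \<inter> Nb (f b))"
    "\<And>b b'. b \<in> B - (I \<union> f ` I) \<Longrightarrow> b' \<in> B - (I \<union> f ` I) \<Longrightarrow> g \<le> card (Nb b \<inter> Nb b') \<Longrightarrow> b = b'"
    by (rule maximal_matching[OF BQ(1), of "\<lambda>b b'. g \<le> card (Nb b \<inter> Nb b')"]) (rule that)
  define B' where "B' = B - (I \<union> f ` I)"
  have cB: "card B' + 2 * card I = card B"
    unfolding B'_def by (rule card_matching) (use I BQ in auto)
  show ?thesis
  proof (cases "card B \<le> 4 * card I")
    case True
    have "card I * g \<le> self_similarity G"
      by (rule self_similarity_ge_overlaps[OF G BQ(1,3), of Nb id I f]) (use Nb I finQ in auto)
    moreover have "card B * g \<le> 4 * (card I * g)" using True by simp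
    ultimately show ?thesis by linarith
  next
    case False
    \<comment> \<open>Fewer than half of the vertices have been used up. Hence \<open>q\<close> and
      \<open>pq\<close> ask for twice what the random matching needs, and
      \<open>192 = 2 * 96\<close>.\<close>
    then have half: "card B \<le> 2 * card B'" using cB by linarith
    have "0 \<le> p" unfolding p_def by (intro divide_nonneg_nonneg of_nat_0_le_iff)
    then have "p * real (card B) \<le> p * (2 * real (card B'))"
      using half by (intro mult_left_mono) linarith+
    then have pq': "1 \<le> p * real (card B')" using pq by linarith
    have sub: "B' \<subseteq> B" by (auto simp: B'_def)
    have finB': "finite B'" using sub BQ(1) by (rule finite_subset)
    obtain \<pi> J h where J: "\<pi> permutes U" "J \<subseteq> B'" "h ` J \<subseteq> B'" "inj_on h J" "J \<inter> h ` J = {}"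
      "\<And>b. b \<in> J \<Longrightarrow> g \<le> card (\<pi> ` Nb b \<inter> Nb (h b))" "real (card B') \<le> 96 * real (card J)"
    proof (rule matching_of_large_overlaps[OF U finB', of Nb g])
      show "Nb b \<subseteq> U" "card (Nb b) = D" if "b \<in> B'" for b
        using Nb[of b] that sub BQ(2) by blast+
      show "card (Nb b \<inter> Nb b') \<le> g" if "b \<in> B'" "b' \<in> B'" "b \<noteq> b'" for b b'
        using I(6)[of b b'] that by (auto simp: B'_def)
      show "2 \<le> card B'" using half q by linarith
    qed (use pq' pp in \<open>simp_all only: p_def\<close>)
    have "card J * g \<le> self_similarity G"
    proof (rule self_similarity_ge_overlaps[OF G finB', of Q Nb \<pi> J h])
      show "inj \<pi>" using J(1) by (rule permutes_inj)
      show "B' \<inter> Q = {}" using sub BQ(3) by blast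
      show "Nb b \<subseteq> Q" if "b \<in> B'" for b using Nb that sub by blast
      show "{b, a} \<in> edges G" if "b \<in> B'" "a \<in> Nb b" for b a using Nb that sub by blast
    qed (use J finQ in auto)
    moreover have "card B \<le> 192 * card J" using half J(7) by linarith
    then have "card B * g \<le> 192 * (card J * g)" using mult_right_mono[of "card B" "192 * card J" g] by simp
    ultimately show ?thesis by linarith
  qed
qed

section \<open>Degree counting and the extraction of a bipartite core\<close>

lemma card_neighbours:
  assumes G: "finite_simple_graph G" and v: "v \<in> U"
  shows "card {w\<in>U. {v, w} \<in> edges G} = card {e\<in>edges G. e \<subseteq> U \<and> v \<in> e}"
proof (rule bij_betw_same_card[of "\<lambda>w. {v, w}"], rule bij_betw_imageI)
  show "inj_on (\<lambda>w. {v, w}) {w\<in>U. {v, w} \<in> edges G}"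
    by (rule inj_onI) (auto simp: doubleton_eq_iff)
  show "(\<lambda>w. {v, w}) ` {w\<in>U. {v, w} \<in> edges G} = {e\<in>edges G. e \<subseteq> U \<and> v \<in> e}"
  proof (intro equalityI subsetI)
    fix e assume e: "e \<in> {e\<in>edges G. e \<subseteq> U \<and> v \<in> e}"
    then have "card e = 2" using edge_card[OF G] by blast
    then obtain x y where xy: "e = {x, y}" by (auto simp: card_2_iff)
    then have "e = {v, if v = x then y else x}" using e by auto
    then show "e \<in> (\<lambda>w. {v, w}) ` {w\<in>U. {v, w} \<in> edges G}" using e xy by blast
  qed (use v in auto)
qed

lemma sum_card_neighbours:
  assumes G: "finite_simple_graph G" and U: "finite U"
  shows "(\<Sum>v\<in>U. card {w\<in>U. {v, w} \<in> edges G}) = 2 * card {e\<in>edges G. e \<subseteq> U}"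
proof -
  define E where "E = {e\<in>edges G. e \<subseteq> U}"
  have finE: "finite E" using finite_edges[OF G] by (simp add: E_def)
  have "(\<Sum>v\<in>U. card {w\<in>U. {v, w} \<in> edges G}) = (\<Sum>v\<in>U. card {e\<in>E. v \<in> e})"
    by (intro sum.cong refl) (simp add: card_neighbours[OF G] E_def)
  also have "\<dots> = (\<Sum>v\<in>U. \<Sum>e\<in>E. of_bool (v \<in> e))"
    using finE by (simp add: of_bool_def sum.If_cases Int_def)
  also have "\<dots> = (\<Sum>e\<in>E. \<Sum>v\<in>U. of_bool (v \<in> e))" by (rule sum.swap)
  also have "\<dots> = (\<Sum>e\<in>E. card {v\<in>U. v \<in> e})"
    using U by (simp add: of_bool_def sum.If_cases Int_def)
  also have "\<dots> = (\<Sum>e\<in>E. 2)"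
  proof (intro sum.cong refl)
    fix e assume e: "e \<in> E"
    then have "{v\<in>U. v \<in> e} = e" by (auto simp: E_def)
    then show "card {v\<in>U. v \<in> e} = 2" using e edge_card[OF G] by (simp add: E_def)
  qed
  finally show ?thesis by (simp add: E_def)
qed

lemma card_edges_diff_le:
  assumes G: "finite_simple_graph G" and U: "finite U" "S \<subseteq> U"
  shows "card {e\<in>edges G. e \<subseteq> U} \<le> card {e\<in>edges G. e \<subseteq> S} + (\<Sum>v\<in>U - S. card {w\<in>U. {v, w} \<in> edges G})"
proof -
  have fin: "finite {e\<in>edges G. Q e}" for Q using finite_edges[OF G] by simp
  have "{e\<in>edges G. e \<subseteq> U} \<subseteq> {e\<in>edges G. e \<subseteq> S} \<union> (\<Union>v\<in>U - S. {e\<in>edges G. e \<subseteq> U \<and> v \<in> e})"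
    by blast
  then have "card {e\<in>edges G. e \<subseteq> U} \<le>
      card ({e\<in>edges G. e \<subseteq> S} \<union> (\<Union>v\<in>U - S. {e\<in>edges G. e \<subseteq> U \<and> v \<in> e}))"
    by (rule card_mono[rotated]) (use fin U in auto)
  also have "\<dots> \<le> card {e\<in>edges G. e \<subseteq> S} + card (\<Union>v\<in>U - S. {e\<in>edges G. e \<subseteq> U \<and> v \<in> e})"
    by (rule card_Un_le)
  also have "card (\<Union>v\<in>U - S. {e\<in>edges G. e \<subseteq> U \<and> v \<in> e}) \<le>
      (\<Sum>v\<in>U - S. card {e\<in>edges G. e \<subseteq> U \<and> v \<in> e})" using U by (intro card_UN_le) simp
  also have "\<dots> = (\<Sum>v\<in>U - S. card {w\<in>U. {v, w} \<in> edges G})"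
    by (intro sum.cong refl) (simp add: card_neighbours[OF G])
  finally show ?thesis by simp
qed

text \<open>At least \<open>L\<close> edges meet \<open>U - S\<close>, where degrees are at most
  \<open>h\<close>. Degrees below \<open>L / (2 * card U)\<close> account for at most
  \<open>L / 2\<close> in total, so at least \<open>L / (2 * h)\<close> vertices of larger degree
  remain. A maximum cut halves their degrees, and the side holding more of them keeps at least
  half.\<close>

lemma bipartite_core:
  fixes h L :: real
  assumes G: "finite_simple_graph G" and U: "finite U" "U \<noteq> {}" and h: "0 < h"
  defines "S \<equiv> {v\<in>U. h < real (card {w\<in>U. {v, w} \<in> edges G})}"
  assumes L: "real (card {e\<in>edges G. e \<subseteq> S}) + L \<le> real (card {e\<in>edges G. e \<subseteq> U})"
  obtains B Q where "B \<subseteq> U" "Q \<subseteq> U" "B \<inter> Q = {}"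
    "\<And>b. b \<in> B \<Longrightarrow> L / (4 * real (card U)) \<le> real (card {w\<in>Q. {b, w} \<in> edges G})"
    "L \<le> 4 * h * real (card B)"
proof -
  define d where "d v = real (card {w\<in>U. {v, w} \<in> edges G})" for v
  define u where "u = real (card U)"
  have u: "0 < u" using U by (simp add: u_def card_gt_0_iff)
  define B' where "B' = {v\<in>U - S. L / (2 * u) \<le> d v}"
  have finB': "finite B'" using U(1) by (simp add: B'_def)
  have "real (card {e\<in>edges G. e \<subseteq> U}) \<le> real (card {e\<in>edges G. e \<subseteq> S} + (\<Sum>v\<in>U - S. card {w\<in>U. {v, w} \<in> edges G}))"
    by (intro of_nat_mono card_edges_diff_le[OF G U(1)]) (auto simp: S_def)
  then have "L \<le> (\<Sum>v\<in>U - S. d v)" using L by (simp add: d_def)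
  also have "\<dots> = (\<Sum>v\<in>B'. d v) + (\<Sum>v\<in>U - S - B'. d v)"
    by (subst sum.subset_diff[of B' "U - S"]) (use U(1) in \<open>auto simp: B'_def\<close>)
  also have "\<dots> \<le> (\<Sum>v\<in>B'. h) + (\<Sum>v\<in>U - S - B'. L / (2 * u))"
    by (intro add_mono sum_mono) (auto simp: B'_def S_def d_def)
  also have "\<dots> \<le> real (card B') * h + L / 2" if "0 \<le> L"
  proof -
    have "real (card (U - S - B')) \<le> u" unfolding u_def using U(1) by (intro of_nat_mono card_mono) auto
    then have "real (card (U - S - B')) * (L / (2 * u)) \<le> u * (L / (2 * u))"
      using that u by (intro mult_right_mono) auto
    then show ?thesis using u by simp
  qed
  finally have large: "L \<le> 2 * h * real (card B')" if "0 \<le> L"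
    using that by (simp add: mult_ac)
  have large: "L \<le> 2 * h * real (card B')"
  proof (cases "0 \<le> L")
    case False
    then show ?thesis using h by (auto intro: order_trans[of _ 0])
  qed (rule large)
  obtain P where P: "P \<subseteq> U" and cut: "\<And>v. v \<in> U \<Longrightarrow> card {w\<in>U. {v, w} \<in> edges G} \<le>
      2 * card {w\<in>U. {v, w} \<in> edges G \<and> (w \<in> P) \<noteq> (v \<in> P)}"
  proof (rule max_cut[OF U(1), of "\<lambda>v w. {v, w} \<in> edges G"])
    show "{x, y} \<in> edges G \<longleftrightarrow> {y, x} \<in> edges G" for x y by (simp add: insert_commute)
    show "{x, x} \<notin> edges G" for x using edge_card[OF G, of "{x, x}"] by auto
  qed (rule that)
  have deg: "L / (4 * u) \<le> real (card {w\<in>U. {b, w} \<in> edges G \<and> (w \<in> P) \<noteq> (b \<in> P)})" if "b \<in> B'" for b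
  proof -
    have "L / (2 * u) \<le> d b" "b \<in> U" using that by (simp_all add: B'_def)
    moreover have "d b \<le> 2 * real (card {w\<in>U. {b, w} \<in> edges G \<and> (w \<in> P) \<noteq> (b \<in> P)})"
      unfolding d_def using cut[OF \<open>b \<in> U\<close>] by linarith
    ultimately show ?thesis by simp
  qed
  have cB': "card B' = card (B' \<inter> P) + card (B' - P)" using finB' by (rule card_Int_Diff)
  show ?thesis
  proof (cases "card (B' - P) \<le> card (B' \<inter> P)")
    case True
    show ?thesis
    proof (rule that[of "B' \<inter> P" "U - P"])
      show "B' \<inter> P \<subseteq> U" by (auto simp: B'_def)
      fix b assume b: "b \<in> B' \<inter> P"
      then have "{w\<in>U - P. {b, w} \<in> edges G} = {w\<in>U. {b, w} \<in> edges G \<and> (w \<in> P) \<noteq> (b \<in> P)}" by auto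
      then show "L / (4 * real (card U)) \<le> real (card {w\<in>U - P. {b, w} \<in> edges G})"
        using deg[of b] b by (simp add: u_def)
    next
      have "real (card B') \<le> 2 * real (card (B' \<inter> P))" using True cB' by linarith
      then have "2 * h * real (card B') \<le> 2 * h * (2 * real (card (B' \<inter> P)))"
        using h by (intro mult_left_mono) auto
      then show "L \<le> 4 * h * real (card (B' \<inter> P))" using large by simp
    qed auto
  next
    case False
    show ?thesis
    proof (rule that[of "B' - P" P])
      show "B' - P \<subseteq> U" by (auto simp: B'_def)
      fix b assume b: "b \<in> B' - P"
      then have "{w\<in>P. {b, w} \<in> edges G} = {w\<in>U. {b, w} \<in> edges G \<and> (w \<in> P) \<noteq> (b \<in> P)}" using P by auto
      then show "L / (4 * real (card U)) \<le> real (card {w\<in>P. {b, w} \<in> edges G})"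
        using deg[of b] b by (simp add: u_def)
    next
      have "real (card B') \<le> 2 * real (card (B' - P))" using False cB' by linarith
      then have "2 * h * real (card B') \<le> 2 * h * (2 * real (card (B' - P)))"
        using h by (intro mult_left_mono) auto
      then show "L \<le> 4 * h * real (card (B' - P))" using large by simp
    qed (use P in auto)
  qed
qed

section \<open>The critical number of vertices\<close>

text \<open>With about \<open>scale m\<close> vertices, a random permutation maps \<open>m\<^sup>2 / (scale m)\<^sup>2 = scale m * ln m\<close>
  edges to edges.\<close>

definition scale :: "real \<Rightarrow> real" where "scale x = x powr (2/3) * ln x powr (-1/3)"

lemma scale_cubed:
  assumes "1 < x"
  shows "scale x ^ 3 * ln x = x\<^sup>2"
proof -
  have "(x powr (2/3)) ^ 3 = x\<^sup>2"
    using assms by (simp add: powr_power)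
  moreover have "(ln x powr (-1/3)) ^ 3 * ln x = 1"
  proof -
    have "(ln x powr (-1/3)) ^ 3 = ln x powr (-1)" using assms by (simp add: powr_power)
    also have "\<dots> = inverse (ln x)" using assms by (simp add: powr_minus)
    finally show ?thesis using assms by simp
  qed
  ultimately show ?thesis by (simp add: scale_def power_mult_distrib mult.assoc)
qed

lemma scale_mult_ln:
  assumes "1 < x"
  shows "scale x * ln x = (x * ln x) powr (2/3)"
proof -
  have "ln x powr (-1/3) * ln x powr 1 = ln x powr (2/3)"
    by (simp only: powr_add[symmetric]) simp
  then show ?thesis using assms by (simp add: scale_def powr_mult mult.assoc)
qed

lemma scale_pos: "1 < x \<Longrightarrow> 0 < scale x"
  by (simp add: scale_def)

section \<open>Asymptotic inequalities and the choice of degree and overlap\<close>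

text \<open>Multiplied by \<open>ln m\<close>, the left side bounds the exponent lost in the tail
  estimate: at most \<open>2 * ln m / k\<close> factors that are at least
  \<open>1 / (1024 * k^7)\<close>, and the cost of avoiding the set elsewhere.\<close>

lemma eventually_entropy_bound:
  "\<forall>\<^sub>F k :: real in at_top. 2 / k * ln (1024 * k ^ 7) + 1 / (16 * k ^ 8) \<le> 1 / 20"
  by real_asymp

text \<open>With \<open>x = m\<close>, the inequalities after the first give in turn:
  \<open>D\<close> large against \<open>g\<close>; \<open>D\<close> small against
  \<open>card U\<close>; \<open>g * D / card U\<close> below the square of the overlap probability;
  enough expected partners; room for additive constants; and, from the last three, that
  \<open>m\<close> edges fit on about \<open>scale m\<close> vertices and
  \<open>ln n <= ln m\<close>.\<close>

lemma eventually_scale_bounds: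
  "\<forall>\<^sub>F x :: real in at_top. 1 \<le> ln x \<and>
     8 * ln x + 2 \<le> x / (8 * ln x powr (3/2) * scale x) \<and>
     x \<le> 2 * (scale x)\<^sup>2 \<and>
     ln x * x / (4 * (scale x)\<^sup>2) \<le> x powr (-1/10) \<and>
     4 \<le> x powr (-1/20) * scale x / 64 \<and> 16 \<le> scale x * ln x \<and>
     scale x \<ge> 2 \<and> 2 * scale x \<le> x \<and> x \<le> (scale x)\<^sup>2 / 4"
  unfolding scale_def by (intro eventually_conj; real_asymp)

text \<open>\<open>N\<close> stands for \<open>card U\<close>, and \<open>D\<close> is the degree
  that the bipartite core guarantees for a gap of \<open>m / (2 * k)\<close>. The mean overlap
  \<open>D^2 / N\<close> lies between \<open>l / (256 * k^8)\<close> and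
  \<open>l / (64 * k^8)\<close>, well below the target \<open>l / k\<close>.\<close>

lemma overlap_parameters:
  fixes m k u n0 l :: real and N :: nat
  defines "l \<equiv> ln m" and "n0 \<equiv> scale m"
  assumes m: "1 < m" and l: "1 \<le> l"
    and b1: "8 * l + 2 \<le> m / (8 * l powr (3/2) * n0)" and b2: "m \<le> 2 * n0\<^sup>2"
    and b3: "l * m / (4 * n0\<^sup>2) \<le> m powr (-1/10)"
    and k: "1 \<le> k" "k\<^sup>2 \<le> l" "2 / k * ln (1024 * k ^ 7) + 1 / (16 * k ^ 8) \<le> 1 / 20"
    and N: "real N = k\<^sup>2 * n0"
  defines "D \<equiv> nat \<lfloor>m / (8 * real N * k)\<rfloor>" and "g \<equiv> nat \<lceil>l / k\<rceil>"
  defines "p \<equiv> real (\<Sum>i=g..D. (D choose i) * ((N - D) choose (D - i))) / real (N choose D)"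
  shows "D \<le> N" "m powr (-1/20) \<le> p" "real g * real D / real N \<le> p\<^sup>2" "l / k \<le> real g"
proof -
  have n0: "0 < n0" unfolding n0_def using m by (rule scale_pos)
  have cube: "n0 ^ 3 * l = m\<^sup>2" unfolding n0_def l_def using m by (rule scale_cubed)
  have kpos: "0 < k" "0 < real N" using k(1) n0 N by auto
  define x where "x = m / (8 * real N * k)"
  have x_eq: "x = m / (8 * k ^ 3 * n0)"
    by (simp add: x_def N power2_eq_square power3_eq_cube mult_ac)
  \<comment> \<open>The largest admissible \<open>k\<close> is \<open>sqrt l\<close>, which is why
    \<open>b1\<close> contains \<open>l powr (3/2)\<close>.\<close>
  have "k ^ 3 \<le> l powr (3/2)"
  proof -
    have "k = (k\<^sup>2) powr (1/2)" using kpos by (simp add: powr_half_sqrt)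
    also have "\<dots> \<le> l powr (1/2)" using k(2) by (intro powr_mono2) auto
    finally have "k ^ 3 \<le> (l powr (1/2)) ^ 3" using kpos by (intro power_mono) auto
    then show ?thesis using l by (simp add: powr_power)
  qed
  then have "m / (8 * l powr (3/2) * n0) \<le> x"
    unfolding x_eq using m n0 kpos by (intro divide_left_mono mult_right_mono mult_left_mono mult_pos_pos) auto
  then have x: "8 * l + 2 \<le> x" using b1 by linarith
  have D_le: "real D \<le> x" using x l by (simp add: D_def x_def[symmetric])
  have D_ge: "x / 2 \<le> real D" using x l unfolding D_def x_def[symmetric] by linarith
  have lk: "1 \<le> l / k"
  proof -
    have "k \<le> k\<^sup>2" using k(1) by (simp add: power2_eq_square)
    then show ?thesis using k(2) kpos by simp
  qed
  show g_ge: "l / k \<le> real g" unfolding g_def by linarith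
  have g_le: "real g \<le> 2 * (l / k)" using lk unfolding g_def by linarith
  have "l / k \<le> l" using k(1) l by (simp add: divide_le_eq)
  have g1: "1 \<le> g" using g_ge lk by linarith
  have gD: "2 * g \<le> D" using g_le \<open>l / k \<le> l\<close> D_ge x by linarith
  have DN: "4 * D \<le> N"
  proof -
    have "4 * x = m / (2 * k ^ 3 * n0)" by (simp add: x_eq)
    also have "\<dots> \<le> m / (2 * 1 * n0)"
      using m n0 k(1) by (intro divide_left_mono mult_right_mono mult_left_mono mult_pos_pos) auto
    also have "\<dots> \<le> n0" using b2 n0 by (simp add: divide_le_eq power2_eq_square)
    also have "\<dots> \<le> k\<^sup>2 * n0" using k(1) n0 by simp
    finally show ?thesis using D_le N by linarith
  qed
  then show "D \<le> N" by simp
  have xN: "x\<^sup>2 / real N = l / (64 * k ^ 8)"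
  proof -
    have "x\<^sup>2 / real N = m\<^sup>2 / (64 * k ^ 8 * n0 ^ 3)"
      using kpos n0 by (simp add: x_eq N field_simps power2_eq_square power3_eq_cube eval_nat_numeral)
    also have "\<dots> = l / (64 * k ^ 8)" unfolding cube[symmetric] using n0 by simp
    finally show ?thesis .
  qed
  have upper: "(real D)\<^sup>2 / real N \<le> l / (64 * k ^ 8)"
    unfolding xN[symmetric] using D_le kpos by (intro divide_right_mono power_mono) auto
  have "l / (256 * k ^ 8) = (x / 2)\<^sup>2 / real N" using xN by (simp add: power_divide)
  also have "\<dots> \<le> (real D)\<^sup>2 / real N"
    using D_ge kpos x l by (intro divide_right_mono power_mono) auto
  finally have lower: "l / (256 * k ^ 8) \<le> (real D)\<^sup>2 / real N" .
  \<comment> \<open>\<open>1024 = 64 * 4 * 4\<close>: from \<open>xN\<close>, from rounding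
    \<open>D\<close> down to no less than \<open>x / 2\<close>, and from
    \<open>2 * g <= 4 * l / k\<close>.\<close>
  have base: "1 / (1024 * k ^ 7) \<le> (real D)\<^sup>2 / (2 * real N * real g)"
  proof -
    have "1 / (1024 * k ^ 7) = l / (256 * k ^ 8) / (2 * (2 * (l / k)))"
      using kpos l by (simp add: field_simps eval_nat_numeral)
    also have "\<dots> \<le> (real D)\<^sup>2 / real N / (2 * real g)"
      by (rule frac_le) (use lower g_le g1 in auto)
    finally show ?thesis by (simp add: mult_ac)
  qed
  have ln0: "0 \<le> ln (1024 * k ^ 7)"
  proof -
    have "1 \<le> k ^ 7" using k(1) by (rule one_le_power)
    then show ?thesis by (intro ln_ge_zero) simp
  qed
  have "exp (- (2 * (l / k)) * ln (1024 * k ^ 7)) \<le> exp (- real g * ln (1024 * k ^ 7))"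
    using mult_right_mono[OF g_le ln0] by simp
  also have "\<dots> = (1 / (1024 * k ^ 7)) ^ g"
    using kpos by (simp add: exp_minus exp_of_nat_mult power_divide inverse_eq_divide)
  also have "\<dots> \<le> ((real D)\<^sup>2 / (2 * real N * real g)) ^ g"
    using base kpos by (intro power_mono) auto
  finally have e1: "exp (- (2 * (l / k)) * ln (1024 * k ^ 7)) \<le> ((real D)\<^sup>2 / (2 * real N * real g)) ^ g" .
  have e2: "exp (- (l / (16 * k ^ 8))) \<le> exp (- 4 * (real D)\<^sup>2 / real N)"
    using upper by simp
  have "m powr (-1/20) = exp (- l / 20)" using m by (simp add: powr_def l_def)
  also have "\<dots> \<le> exp (- l * (2 / k * ln (1024 * k ^ 7) + 1 / (16 * k ^ 8)))"
    using mult_left_mono[OF k(3), of l] l by simp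
  also have "\<dots> = exp (- (2 * (l / k)) * ln (1024 * k ^ 7)) * exp (- (l / (16 * k ^ 8)))"
    by (simp add: exp_add[symmetric] algebra_simps)
  also have "\<dots> \<le> ((real D)\<^sup>2 / (2 * real N * real g)) ^ g * exp (- 4 * (real D)\<^sup>2 / real N)"
    by (intro mult_mono e1 e2) auto
  also have "\<dots> \<le> p"
    unfolding p_def by (rule hypergeometric_tail_ge[OF g1 gD DN])
  finally show p: "m powr (-1/20) \<le> p" .
  \<comment> \<open>Bounds uniform in \<open>k\<close> are enough: up to powers of \<open>l\<close>
    the result is \<open>m^(-1/3)\<close>.\<close>
  have "real g * real D / real N \<le> (2 * l) * (m / (8 * n0)) / n0"
  proof (intro frac_le mult_mono)
    show "real g \<le> 2 * l" using g_le \<open>l / k \<le> l\<close> by linarith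
    have "x \<le> m / (8 * 1 * n0)"
      unfolding x_eq using m n0 k(1) by (intro divide_left_mono mult_right_mono mult_left_mono mult_pos_pos) auto
    then show "real D \<le> m / (8 * n0)" using D_le by simp
    show "n0 \<le> real N" unfolding N using k(1) n0 by simp
  qed (use l n0 m in auto)
  also have "\<dots> = l * m / (4 * n0\<^sup>2)" by (simp add: power2_eq_square)
  also have "\<dots> \<le> m powr (-1/10)" by (rule b3)
  also have "\<dots> = (m powr (-1/20))\<^sup>2" using m by (simp add: powr_power)
  also have "\<dots> \<le> p\<^sup>2" using p by (intro power_mono) auto
  finally show "real g * real D / real N \<le> p\<^sup>2" .
qed

section \<open>Both bounds\<close>

lemma self_similarity_ge_scale:
  fixes G :: "'a sgraph" and K :: real
  assumes G: "finite_simple_graph G" "card (edges G) = m"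
    and K: "2 \<le> K" "\<And>k. K \<le> k \<Longrightarrow> 2 / k * ln (1024 * k ^ 7) + 1 / (16 * k ^ 8) \<le> 1 / 20"
    and m: "4 \<le> m" "1 \<le> ln (real m)"
      "8 * ln (real m) + 2 \<le> real m / (8 * ln (real m) powr (3/2) * scale (real m))"
      "real m \<le> 2 * (scale (real m))\<^sup>2"
      "ln (real m) * real m / (4 * (scale (real m))\<^sup>2) \<le> real m powr (-1/10)"
      "4 \<le> real m powr (-1/20) * scale (real m) / 64"
      "16 \<le> scale (real m) * ln (real m)"
  shows "min (1/12288) (1 / (12 * K ^ 4)) * (scale (real m) * ln (real m)) \<le> real (self_similarity G)"
proof -
  define n0 where "n0 = scale (real m)"
  define l where "l = ln (real m)"
  define V where "V = \<Union>(edges G)"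
  define a where "a U = real (card {e\<in>edges G. e \<subseteq> U})" for U
  \<comment> \<open>At \<open>card U = k^2 * n0\<close> the second condition allows a loss of
    \<open>m / (2 * k)\<close> edges. For nonempty sets below \<open>n0\<close> vertices it would
    ask for less than half of the edges, so the first takes over.\<close>
  define good where "good U \<longleftrightarrow> U \<subseteq> V \<and> real m / 2 \<le> a U \<and> real m * (1 - sqrt (n0 / real (card U)) / 2) \<le> a U" for U
  have n0: "0 < n0" unfolding n0_def using m(1) by (intro scale_pos) simp
  have l: "1 \<le> l" using m(2) by (simp add: l_def)
  have cube: "n0 ^ 3 * l = (real m)\<^sup>2" unfolding n0_def l_def using m(1) by (intro scale_cubed) simp
  have finV: "finite V"
    unfolding V_def using finite_edges[OF G(1)] edge_card[OF G(1)]
    by (intro finite_Union) (auto intro: card_ge_0_finite)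
  have weaken: ?thesis if "c * (n0 * l) \<le> real (self_similarity G)" "min (1/12288) (1 / (12 * K ^ 4)) \<le> c" for c
  proof -
    have "min (1/12288) (1 / (12 * K ^ 4)) * (n0 * l) \<le> c * (n0 * l)"
      using that(2) n0 l by (intro mult_right_mono) auto
    then show ?thesis using that(1) by (simp add: n0_def l_def)
  qed
  show ?thesis
  proof (cases "n0 * l \<le> real (card V)")
    case True
    have "real (card V) \<le> real (16 * self_similarity G + 8)"
      unfolding V_def by (intro of_nat_mono self_similarity_ge_vertices[OF G(1)])
    then have "1/32 * (n0 * l) \<le> real (self_similarity G)"
      using True m(7) by (simp add: n0_def l_def)
    then show ?thesis by (rule weaken) simp
  next
    case False
    have "{e\<in>edges G. e \<subseteq> V} = edges G" by (auto simp: V_def)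
    then have aV: "a V = real m" by (simp add: a_def G(2))
    have "good V" using aV n0 by (simp add: good_def mult_left_le)
    then obtain U where U: "good U" and min: "\<And>U'. good U' \<Longrightarrow> card U \<le> card U'"
      using ex_has_least_nat[of good V card] by blast
    define u where "u = real (card U)"
    have UV: "U \<subseteq> V" and aU: "real m / 2 \<le> a U" "real m * (1 - sqrt (n0 / u) / 2) \<le> a U"
      using U by (simp_all add: good_def u_def)
    have finU: "finite U" using UV finV by (rule finite_subset)
    have Une: "U \<noteq> {}"
    proof
      assume "U = {}"
      then have empty: "{e\<in>edges G. e \<subseteq> U} = {}" using edge_card[OF G(1)] by force
      have "a U = 0" unfolding a_def empty by simp
      then show False using aU(1) m(1) by simp
    qed
    have u: "0 < u" using Une finU by (simp add: u_def card_gt_0_iff)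
    show ?thesis
    proof (cases "u \<le> K\<^sup>2 * n0")
      case True
      define t where "t = card {e\<in>edges G. e \<subseteq> U}"
      have t: "a U = real t" "2 \<le> real t" using aU(1) m(1) by (simp_all add: a_def t_def)
      have "t * (t - 1) \<le> 3 * (card U choose 2) * self_similarity G"
        unfolding t_def by (rule self_similarity_ge_density[OF G(1) finU])
      then have "2 * (t * (t - 1)) \<le> 3 * (2 * (card U choose 2)) * self_similarity G"
        by (simp add: mult_ac)
      also have "\<dots> \<le> 3 * (card U * card U) * self_similarity G"
      proof (intro mult_right_mono mult_left_mono)
        have "2 * (card U choose 2) \<le> card U * (card U - 1)"
          by (simp add: choose_two)
        also have "\<dots> \<le> card U * card U" by simp
        finally show "2 * (card U choose 2) \<le> card U * card U" .
      qed auto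
      finally have nat: "2 * (t * (t - 1)) \<le> 3 * (card U * card U) * self_similarity G" .
      have "2 * (real t * (real t - 1)) = real (2 * (t * (t - 1)))"
        using t(2) by (simp add: of_nat_diff)
      also have "\<dots> \<le> real (3 * (card U * card U) * self_similarity G)"
        using nat by (rule of_nat_mono)
      also have "\<dots> = 3 * u\<^sup>2 * real (self_similarity G)"
        by (simp add: u_def power2_eq_square)
      finally have "2 * (real t * (real t - 1)) \<le> 3 * u\<^sup>2 * real (self_similarity G)" .
      moreover have "real t * (real t / 2) \<le> real t * (real t - 1)"
        using t(2) by (intro mult_left_mono) auto
      moreover have "(real m / 2)\<^sup>2 \<le> (real t)\<^sup>2"
        using aU(1) t(1) by (intro power_mono) auto
      \<comment> \<open>From \<open>t >= m / 2\<close> and \<open>t - 1 >= t / 2\<close>; the factor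
        \<open>K^4\<close> enters next through \<open>u <= K^2 * n0\<close>.\<close>
      ultimately have "(real m)\<^sup>2 \<le> 12 * u\<^sup>2 * real (self_similarity G)"
        by (simp add: power2_eq_square field_simps)
      also have "\<dots> \<le> 12 * (K\<^sup>2 * n0)\<^sup>2 * real (self_similarity G)"
        using True u by (intro mult_right_mono mult_left_mono power_mono) auto
      finally have "n0\<^sup>2 * (n0 * l) \<le> n0\<^sup>2 * (12 * K ^ 4 * real (self_similarity G))"
        unfolding cube[symmetric] by (simp add: power2_eq_square power3_eq_cube eval_nat_numeral mult_ac)
      then have "n0 * l \<le> 12 * K ^ 4 * real (self_similarity G)" using n0 by simp
      then have "1 / (12 * K ^ 4) * (n0 * l) \<le> real (self_similarity G)"
        using K(1) by (simp add: divide_le_eq mult_ac)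
      then show ?thesis by (rule weaken) simp
    next
      case False
      define k where "k = sqrt (u / n0)"
      have u_eq: "u = k\<^sup>2 * n0" using u n0 by (simp add: k_def)
      have Kk: "K < k"
      proof (rule power_less_imp_less_base)
        show "K\<^sup>2 < k\<^sup>2" using False n0 u_eq by simp
      qed (use u n0 in \<open>simp add: k_def\<close>)
      have k2: "2 \<le> k" using Kk K(1) by simp
      \<comment> \<open>Failure of the first case bounds \<open>card V\<close>, and hence
        \<open>k^2\<close> by \<open>ln m\<close>; otherwise \<open>D\<close> could be too small for
        the required overlap.\<close>
      have "u \<le> real (card V)" unfolding u_def using UV finV by (intro of_nat_mono card_mono)
      then have "k\<^sup>2 * n0 < l * n0" using \<open>\<not> n0 * l \<le> real (card V)\<close> u_eq by (simp add: mult.commute)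
      then have kl: "k\<^sup>2 \<le> l" using n0 by simp
      \<comment> \<open>Degrees in \<open>U\<close> sum to at most \<open>2 * m\<close>, so at most
        \<open>u / 4\<close> vertices exceed \<open>h\<close>. A quarter of the size doubles the
        square root in \<open>good\<close>.\<close>
      define h where "h = 8 * real m / u"
      define S where "S = {v\<in>U. h < real (card {w\<in>U. {v, w} \<in> edges G})}"
      have h: "0 < h" using m(1) u by (simp add: h_def)
      have SU: "S \<subseteq> U" by (auto simp: S_def)
      have finS: "finite S" using SU finU by (rule finite_subset)
      have aUm: "a U \<le> real m"
        unfolding a_def G(2)[symmetric] using finite_edges[OF G(1)] by (intro of_nat_mono card_mono) auto
      have Su: "real (card S) \<le> u / 4"
      proof -
        have "real (card S) * h = (\<Sum>v\<in>S. h)" by simp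
        also have "\<dots> \<le> (\<Sum>v\<in>S. real (card {w\<in>U. {v, w} \<in> edges G}))"
          by (intro sum_mono) (auto simp: S_def)
        also have "\<dots> \<le> (\<Sum>v\<in>U. real (card {w\<in>U. {v, w} \<in> edges G}))"
          using finU SU by (intro sum_mono2) auto
        also have "\<dots> = real (\<Sum>v\<in>U. card {w\<in>U. {v, w} \<in> edges G})" by simp
        also have "\<dots> = 2 * a U" unfolding sum_card_neighbours[OF G(1) finU] by (simp add: a_def)
        finally have "real (card S) * h \<le> 2 * real m" using aUm by simp
        then show ?thesis using m(1) u by (simp add: h_def field_simps)
      qed
      have "\<not> good S"
        using min[of S] Su u by (auto simp: u_def)
      moreover have "S \<subseteq> V" using SU UV by simp
      ultimately have "a S < real m / 2 \<or> a S < real m * (1 - sqrt (n0 / real (card S)) / 2)"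
        by (auto simp: good_def not_le)
      moreover have aU': "real m * (1 - 1 / (2 * k)) \<le> a U"
      proof -
        have "sqrt (n0 / u) = 1 / k" by (simp add: k_def real_sqrt_divide)
        then have "sqrt (n0 / u) / 2 = 1 / (2 * k)" by simp
        then show ?thesis using aU(2) by (simp only:)
      qed
      \<comment> \<open>If \<open>S\<close> spans less than half of the edges, \<open>k >= 2\<close>
        gives the gap. Otherwise \<open>S\<close> misses at least \<open>m / k\<close> edges while
        \<open>U\<close> misses at most \<open>m / (2 * k)\<close>.\<close>
      ultimately have gap: "a S + real m / (2 * k) \<le> a U"
      proof (elim disjE)
        assume "a S < real m / 2"
        moreover have "real m / (2 * k) \<le> real m / 4" using k2 by (intro divide_left_mono) auto
        moreover have "real m * (1 - 1 / (2 * k)) = real m - real m / (2 * k)" by (simp add: algebra_simps)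
        ultimately show ?thesis using aU' by linarith
      next
        assume aS: "a S < real m * (1 - sqrt (n0 / real (card S)) / 2)"
        show ?thesis
        proof (cases "S = {}")
          case True
          \<comment> \<open>Division by zero yields 0 here, so the square root bound says nothing
            useful; the count \<open>a S = 0\<close> is used directly.\<close>
          then have empty: "{e\<in>edges G. e \<subseteq> S} = {}" using edge_card[OF G(1)] by force
          have "a S = 0" unfolding a_def empty by simp
          moreover have "real m / (2 * k) \<le> real m / 4" using k2 by (intro divide_left_mono) auto
          ultimately show ?thesis using aU(1) by linarith
        next
          case False
          then have cS: "0 < real (card S)" using finS by (simp add: card_gt_0_iff)
          have "2 / k = sqrt (n0 / (u / 4))"
            by (simp add: k_def real_sqrt_divide real_sqrt_mult)
          also have "\<dots> \<le> sqrt (n0 / real (card S))"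
            using Su cS n0 u by (intro real_sqrt_le_mono divide_left_mono) auto
          finally have "1 - sqrt (n0 / real (card S)) / 2 \<le> 1 - 1 / k" by simp
          then have "a S \<le> real m * (1 - 1 / k)"
            using aS mult_left_mono[of _ "1 - 1 / k" "real m"] by fastforce
          also have "\<dots> = real m * (1 - 1 / (2 * k)) - real m / (2 * k)"
            using k2 by (simp add: field_simps)
          finally show ?thesis using aU' by linarith
        qed
      qed
      have gap': "real (card {e\<in>edges G. e \<subseteq> {v\<in>U. h < real (card {w\<in>U. {v, w} \<in> edges G})}}) + real m / (2 * k)
          \<le> real (card {e\<in>edges G. e \<subseteq> U})"
        using gap by (simp only: a_def S_def)
      obtain B Q where B: "B \<subseteq> U" "Q \<subseteq> U" "B \<inter> Q = {}"
        "\<And>b. b \<in> B \<Longrightarrow> real m / (2 * k) / (4 * real (card U)) \<le> real (card {w\<in>Q. {b, w} \<in> edges G})"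
        "real m / (2 * k) \<le> 4 * h * real (card B)"
        by (rule bipartite_core[OF G(1) finU Une h gap']) (rule that)
      define D where "D = nat \<lfloor>real m / (8 * real (card U) * k)\<rfloor>"
      define g where "g = nat \<lceil>ln (real m) / k\<rceil>"
      define p where "p = real (\<Sum>i=g..D. (D choose i) * ((card U - D) choose (D - i))) / real (card U choose D)"
      have params: "D \<le> card U" "real m powr (-1/20) \<le> p" "real g * real D / real (card U) \<le> p\<^sup>2" "l / k \<le> real g"
        unfolding D_def g_def p_def l_def
        by (rule overlap_parameters; use m k2 kl K(2)[of k] Kk u_eq in \<open>simp add: l_def n0_def u_def\<close>)+
      \<comment> \<open>The core has at least \<open>L / (4 * h)\<close> vertices, which is
        \<open>u / (64 * k)\<close> for \<open>L = m / (2 * k)\<close> and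
        \<open>h = 8 * m / u\<close>.\<close>
      have cB: "k * n0 / 64 \<le> real (card B)"
      proof -
        have "real m / (2 * k) * u \<le> 32 * real m * real (card B)"
          using B(5) u by (simp add: h_def field_simps)
        then have "real m * (u / (2 * k)) \<le> real m * (32 * real (card B))"
          by (simp add: mult_ac)
        then have "u / (2 * k) \<le> 32 * real (card B)"
          by (rule mult_left_le_imp_le) (use m(1) in simp)
        moreover have "u / (2 * k) = k * n0 / 2" using k2 by (simp add: u_eq power2_eq_square)
        ultimately show ?thesis by simp
      qed
      have "n0 / 64 \<le> k * n0 / 64" using k2 n0 by simp
      then have cB': "n0 / 64 \<le> real (card B)" using cB by linarith
      have p0: "0 \<le> p" using params(2) powr_ge_zero order_trans by blast
      have "4 \<le> real m powr (-1/20) * (n0 / 64)" using m(6) by (simp add: n0_def)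
      also have "\<dots> \<le> p * real (card B)" using params(2) cB' p0 n0 by (intro mult_mono) auto
      finally have pq: "2 \<le> p * real (card B)" by simp
      have "real m powr (-1/20) \<le> 1 powr (-1/20)" using m(1) by (intro powr_mono2') auto
      then have "real m powr (-1/20) * (n0 / 64) \<le> 1 * (n0 / 64)" using n0 by (intro mult_right_mono) auto
      then have q: "4 \<le> card B"
        using cB' \<open>4 \<le> real m powr (-1/20) * (n0 / 64)\<close> by linarith
      have "card B * g \<le> 192 * self_similarity G"
      proof (rule self_similarity_ge_neighbourhoods[OF G(1) finU Une params(1) _ B(2,3) _ q])
        show "finite B" using B(1) finU by (rule finite_subset)
        fix b assume "b \<in> B"
        then have "real m / (8 * real (card U) * k) \<le> real (card {w\<in>Q. {b, w} \<in> edges G})"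
          using B(4)[of b] by (simp add: mult_ac)
        then show "D \<le> card {w\<in>Q. {b, w} \<in> edges G}" unfolding D_def by linarith
      qed (use pq params(3) in \<open>simp_all only: p_def\<close>)
      then have "real (card B * g) \<le> real (192 * self_similarity G)" by (rule of_nat_mono)
      then have up: "real (card B) * real g \<le> 192 * real (self_similarity G)" by simp
      \<comment> \<open>Here \<open>k\<close> cancels; \<open>12288 = 64 * 192\<close>.\<close>
      have "k * n0 / 64 * (l / k) \<le> real (card B) * real g"
        using cB params(4) k2 l n0 by (intro mult_mono) auto
      moreover have "k * n0 / 64 * (l / k) = n0 * l / 64" using k2 by simp
      ultimately have "1/12288 * (n0 * l) \<le> real (self_similarity G)" using up by linarith
      then show ?thesis by (rule weaken) simp
    qed
  qed
qed

section \<open>The extremal function: graphs attaining it, the upper bound and the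
  conclusion\<close>

lemma exists_graph:
  "\<exists>G :: nat sgraph. finite_simple_graph G \<and> card (edges G) = m"
proof (intro exI conjI)
  let ?E = "(\<lambda>i. {0, Suc i}) ` {..<m}"
  show "finite_simple_graph ({..m}, ?E)"
    by (auto simp: finite_simple_graph_def)
  have "inj_on (\<lambda>i. {0, Suc i}) {..<m}" by (rule inj_onI) (auto simp: doubleton_eq_iff)
  then show "card (edges ({..m}, ?E)) = m" by (simp add: card_image)
qed

lemma min_self_similarity_attained:
  obtains G :: "nat sgraph" where "finite_simple_graph G" "card (edges G) = m"
    "self_similarity G = min_self_similarity m"
proof -
  have "\<exists>s. \<exists>G :: nat sgraph. finite_simple_graph G \<and> card (edges G) = m \<and> self_similarity G = s"
    using exists_graph[of m] by blast
  from LeastI_ex[OF this] show ?thesis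
    using that unfolding min_self_similarity_def by blast
qed

lemma min_self_similarity_le:
  fixes G :: "nat sgraph"
  assumes "finite_simple_graph G" "card (edges G) = m"
  shows "min_self_similarity m \<le> self_similarity G"
  unfolding min_self_similarity_def by (rule Least_le) (use assms in blast)

lemma min_self_similarity_le_scale:
  assumes m: "16 \<le> scale (real m) * ln (real m)" "2 \<le> scale (real m)" "2 * scale (real m) \<le> real m"
    "real m \<le> (scale (real m))\<^sup>2 / 4"
  shows "real (min_self_similarity m) \<le> 37 * (scale (real m) * ln (real m))"
proof -
  define n0 where "n0 = scale (real m)"
  define l where "l = ln (real m)"
  define n where "n = nat \<lceil>n0\<rceil>"
  \<comment> \<open>Since \<open>exp 2 <= 9\<close>, \<open>card {..<n} choose 2 >= n0^2 / 4\<close>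
    and \<open>m^2 = n0^3 * l\<close>, the factor 36 meets the second condition on \<open>s\<close>.
    It also exceeds \<open>n * ln n <= 2 * n0 * l\<close>.\<close>
  define s where "s = nat \<lceil>36 * (n0 * l)\<rceil> + 1"
  have m4: "4 \<le> real m" using m(2,3) by linarith
  have n0: "2 \<le> n0" using m(2) by (simp add: n0_def)
  have l: "0 < l" using m4 by (simp add: l_def)
  have cube: "n0 ^ 3 * l = (real m)\<^sup>2" unfolding n0_def l_def using m4 by (intro scale_cubed) simp
  have n: "n0 \<le> real n" "real n \<le> 2 * n0" using n0 unfolding n_def by linarith+
  have T: "16 \<le> n0 * l" using m(1) by (simp add: n0_def l_def)
  have s: "36 * (n0 * l) < real s" "real s \<le> 36 * (n0 * l) + 2"
    using T unfolding s_def by linarith+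
  have "n0\<^sup>2 / 4 \<le> real (n choose 2)"
  proof -
    have "n0 * (n0 / 2) \<le> real n * (real n - 1)" using n n0 by (intro mult_mono) auto
    moreover have "real (n choose 2) = real n * (real n - 1) / 2"
    proof -
      have "2 * (n choose 2) = n * (n - 1)"
        using binomial_absorption[of 1 n] by (simp add: numeral_2_eq_2)
      then have "2 * real (n choose 2) = real n * real (n - 1)"
        by (metis of_nat_mult of_nat_numeral)
      then show ?thesis using n n0 by (simp add: of_nat_diff)
    qed
    ultimately show ?thesis by (simp add: power2_eq_square)
  qed
  then have N: "n0\<^sup>2 / 4 \<le> real (card {..<n} choose 2)" by simp
  obtain E where E: "finite_simple_graph ({..<n}, E)" "card E = m" "self_similarity ({..<n}, E) < s"
  proof (rule exists_graph_with_small_self_similarity[of "{..<n}" m s])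
    show "{..<n} \<noteq> {}" using n n0 by (auto simp: lessThan_empty_iff)
    show "1 \<le> m" using m4 by linarith
    show "m \<le> card {..<n} choose 2" using N m(4) by (simp add: n0_def)
    have "real n * ln (real n) \<le> (2 * n0) * l"
    proof (intro mult_mono)
      show "ln (real n) \<le> l" unfolding l_def using n n0 m(3) by (intro ln_mono) (auto simp: n0_def)
    qed (use n n0 in auto)
    then show "real (card {..<n}) * ln (real (card {..<n})) < real s" using s T by simp
    have "exp 2 = exp 1 * exp (1 :: real)" by (simp flip: exp_add)
    also have "\<dots> \<le> 3 * 3" using exp_le by (intro mult_mono) auto
    finally have "exp 2 * (real m)\<^sup>2 \<le> 9 * (real m)\<^sup>2" by (intro mult_right_mono) auto
    also have "\<dots> = (n0\<^sup>2 / 4) * (36 * (n0 * l))"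
      unfolding cube[symmetric] by (simp add: power2_eq_square power3_eq_cube)
    also have "\<dots> \<le> real (card {..<n} choose 2) * real s"
      using N s n0 l by (intro mult_mono) auto
    finally show "exp 2 * (real m)\<^sup>2 \<le> real (card {..<n} choose 2) * real s" .
  qed (auto intro: that)
  have "min_self_similarity m \<le> self_similarity ({..<n}, E)"
    by (rule min_self_similarity_le) (use E in auto)
  then have "real (min_self_similarity m) \<le> real s" using E(3) by simp
  also have "\<dots> \<le> 37 * (n0 * l)" using s T by linarith
  finally show ?thesis by (simp add: n0_def l_def)
qed

theorem theorem1p2:
  "\<exists>c C :: real. c > 0 \<and> C > 0 \<and>
     (\<forall>m :: nat. m \<ge> 2 \<longrightarrow>
        c * (real m * ln (real m)) powr (2 / 3) < real (min_self_similarity m) \<and>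
        real (min_self_similarity m) < C * (real m * ln (real m)) powr (2 / 3))"
proof -
  define T where "T m = (real m * ln (real m)) powr (2 / 3)" for m :: nat
  obtain K0 :: real where K0: "\<And>k. K0 \<le> k \<Longrightarrow> 2 / k * ln (1024 * k ^ 7) + 1 / (16 * k ^ 8) \<le> 1 / 20"
    using eventually_entropy_bound unfolding eventually_at_top_linorder by blast
  define K where "K = max 2 K0"
  obtain X :: real where X: "\<forall>x\<ge>X. 1 \<le> ln x \<and>
     8 * ln x + 2 \<le> x / (8 * ln x powr (3/2) * scale x) \<and>
     x \<le> 2 * (scale x)\<^sup>2 \<and>
     ln x * x / (4 * (scale x)\<^sup>2) \<le> x powr (-1/10) \<and>
     4 \<le> x powr (-1/20) * scale x / 64 \<and> 16 \<le> scale x * ln x \<and>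
     scale x \<ge> 2 \<and> 2 * scale x \<le> x \<and> x \<le> (scale x)\<^sup>2 / 4"
    using eventually_scale_bounds unfolding eventually_at_top_linorder by blast
  define M where "M = max 4 (nat \<lceil>X\<rceil>)"
  have MX: "X \<le> real m" if "M \<le> m" for m using that unfolding M_def by linarith
  define c1 where "c1 = min (1/12288) (1 / (12 * K ^ 4))"
  have c1: "0 < c1" by (simp add: c1_def K_def)
  have T_mono: "T m \<le> T m'" if "1 \<le> m" "m \<le> m'" for m m'
    unfolding T_def using that by (intro powr_mono2 mult_mono) auto
  have T1: "1 \<le> T m" if "2 \<le> m" for m
  proof -
    have "1 \<le> ln (4 :: real)" using exp_le ln_ge_iff[of 4 1] by simp
    also have "\<dots> = 2 * ln 2" using ln_realpow[of 2 2] by simp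
    also have "\<dots> \<le> real m * ln (real m)" using that by (intro mult_mono) auto
    finally have "1 \<le> real m * ln (real m)" .
    then show ?thesis unfolding T_def by (intro ge_one_powr_ge_zero) auto
  qed
  have large: "c1 * T m \<le> real (min_self_similarity m)" "real (min_self_similarity m) \<le> 37 * T m"
    if m: "M \<le> m" for m
  proof -
    have m4: "4 \<le> m" using m by (simp add: M_def)
    then have T: "T m = scale (real m) * ln (real m)" unfolding T_def by (subst scale_mult_ln) auto
    note bounds = X[rule_format, OF MX[OF m]]
    obtain G :: "nat sgraph" where G: "finite_simple_graph G" "card (edges G) = m"
      "self_similarity G = min_self_similarity m" by (rule min_self_similarity_attained)
    show "c1 * T m \<le> real (min_self_similarity m)"
      unfolding c1_def T G(3)[symmetric]
      by (rule self_similarity_ge_scale[OF G(1,2)]) (use m4 bounds K0 in \<open>auto simp: K_def\<close>)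
    show "real (min_self_similarity m) \<le> 37 * T m"
      unfolding T by (rule min_self_similarity_le_scale) (use bounds in auto)
  qed
  \<comment> \<open>Below \<open>M\<close> only the trivial bounds
    \<open>1 <= min_self_similarity m <= m\<close> are used, together with
    \<open>1 <= T m <= T M\<close>. Halving \<open>c1\<close> and raising 37 make the inequalities
    strict.\<close>
  define c where "c = min (c1 / 2) (1 / (2 * T M))"
  define C where "C = 38 + real M"
  have TM: "1 \<le> T M" by (rule T1) (simp add: M_def)
  have c: "0 < c" using c1 TM by (simp add: c_def)
  have "c * T m < real (min_self_similarity m) \<and> real (min_self_similarity m) < C * T m" if m: "2 \<le> m" for m
  proof (cases "M \<le> m")
    case True
    have "c * T m \<le> c1 / 2 * T m" using T1[OF m] by (intro mult_right_mono) (auto simp: c_def)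
    also have "\<dots> < c1 * T m" using c1 T1[OF m] by simp
    finally have "c * T m < real (min_self_similarity m)" using large(1)[OF True] by linarith
    moreover have "37 * T m < C * T m" using T1[OF m] by (intro mult_strict_right_mono) (auto simp: C_def)
    ultimately show ?thesis using large(2)[OF True] by linarith
  next
    case False
    obtain G :: "nat sgraph" where G: "finite_simple_graph G" "card (edges G) = m"
      "self_similarity G = min_self_similarity m" by (rule min_self_similarity_attained)
    have "c * T m \<le> 1 / (2 * T M) * T M"
      using T_mono[of m M] False m T1[OF m] TM by (intro mult_mono) (auto simp: c_def)
    also have "\<dots> < 1" using TM by simp
    also have "1 \<le> real (min_self_similarity m)"
      using self_similarity_pos[OF G(1)] G(2,3) m by simp
    finally have lower: "c * T m < real (min_self_similarity m)" .
    have "real (min_self_similarity m) \<le> real m"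
      using self_similarity_le_edges[OF G(1)] G(2,3) by simp
    also have "\<dots> < C * 1" using False by (simp add: C_def)
    also have "\<dots> \<le> C * T m" using T1[OF m] by (intro mult_left_mono) (auto simp: C_def)
    finally show ?thesis using lower by simp
  qed
  then show ?thesis
    using c unfolding T_def by (intro exI[of _ c] exI[of _ C]) (simp add: C_def)
qed

end
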